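(* Let $n\ge1$, $1\le C<\infty$, and let $T\in\mathcal{P}_n(C)$ have minimal polynomial $m=\prod_{i=1}^{|m|}(z-\lambda_i)$ of degree $|m|$. Write $R(\zeta,T)=(\zeta-T)^{-1}$. The following assertions hold. (1) If $|\lambda_i|=1$ for all $i=1,\dots,|m|$, then for any $\zeta\in\mathbb{C}\setminus\{\lambda_1,\dots,\lambda_{|m|}\}$, $$\|R(\zeta,T)\|\le C\,\frac{\sqrt{|m|}}{\min_i|\zeta-\lambda_i|}.$$ (2) If $\zeta=0$ and $r=\min_i|\lambda_i|>0$, then $$\|T^{-1}\|\le C\,\frac{\sqrt{|m|\,(e-r^{2|m|})}}{r^{|m|}}.$$ (3) If $\zeta\in\mathbb{D}$ and $r=\min_i\left|\frac{\zeta-\lambda_i}{1-\bar\lambda_i\zeta}\right|$ is the pseudo-hyperbolic distance between $\zeta$ and $\sigma(T)$, with $r\in(0,1)$, then $$\|R(\zeta,T)\|\le Ce\sqrt2\,\frac{\sqrt{|m|}}{\min_i|1-\bar\lambda_i\zeta|\;r^{|m|}}\sqrt{\frac{1}{1-r|\zeta|}+\frac{1}{2(1-r^2)|m|}}.$$ (4) If $\zeta\in\partial\mathbb{D}$ and $\zeta\notin\sigma(T)$, then $$\|R(\zeta,T)\|\le\frac32\,C\sqrt{e^2-1}\;\frac{|m|}{\min_i|\zeta-\lambda_i|}.$$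
   Context: $\mathbb{D}$ is the open unit disk. $\mathcal{P}_n(C)$ denotes the set of power-bounded $n\times n$ matrices, or more generally algebraic operators on a Banach space (bounded operators annihilated by a nonzero polynomial, with minimal polynomial of degree at most $n$), satisfying $\sup_{k\ge0}\|T^k\|\le C$ for the operator norm $\|\cdot\|$ induced by the given (arbitrary) Banach norm. The minimal polynomial is monic and its zeros $\lambda_i$ are listed with multiplicity; $\sigma(T)$ is the spectrum of $T$, i.e. the set $\{\lambda_1,\dots,\lambda_{|m|}\}$. *)

theory Defs
  imports "HOL-Analysis.Analysis" "HOL-Computational_Algebra.Polynomial"
begin

section \<open>Complex Banach spaces\<close>

text \<open>
  The library class \<open>banach\<close> carries only a real structure. A complex Banach space is a
  real one together with a compatible complex scalar multiplication. The unit law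
  \<open>scaleC 1 x = x\<close> follows from \<open>scaleC_of_real\<close>.
\<close>

class complex_banach = banach +
  fixes scaleC :: "complex \<Rightarrow> 'a \<Rightarrow> 'a"  (infixr \<open>*\<^sub>C\<close> 75)
  assumes scaleC_add_right: "a *\<^sub>C (x + y) = a *\<^sub>C x + a *\<^sub>C y"
    and scaleC_add_left: "(a + b) *\<^sub>C x = a *\<^sub>C x + b *\<^sub>C x"
    and scaleC_scaleC: "a *\<^sub>C b *\<^sub>C x = (a * b) *\<^sub>C x"
    and scaleC_of_real: "complex_of_real r *\<^sub>C x = r *\<^sub>R x"
    and norm_scaleC: "norm (a *\<^sub>C x) = cmod a * norm x"

instantiation complex :: complex_banach
begin

definition scaleC_complex :: "complex \<Rightarrow> complex \<Rightarrow> complex"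
  where "scaleC_complex = (*)"

instance
  by standard (auto simp: scaleC_complex_def algebra_simps norm_mult scaleR_conv_of_real)

end

instantiation vec :: (complex_banach, finite) complex_banach
begin

definition scaleC_vec :: "complex \<Rightarrow> ('a, 'b) vec \<Rightarrow> ('a, 'b) vec"
  where "scaleC_vec a x = (\<chi> i. a *\<^sub>C (x $ i))"

instance
proof
  fix a b :: complex and r :: real and x y :: "('a, 'b) vec"
  show "norm (a *\<^sub>C x) = cmod a * norm x"
    by (simp add: norm_vec_def scaleC_vec_def norm_scaleC L2_set_right_distrib)
qed (auto simp: scaleC_vec_def vec_eq_iff scaleC_add_right scaleC_add_left scaleC_scaleC
      scaleC_of_real)

end

lemma scaleC_one [simp]: "1 *\<^sub>C x = x"
  for x :: "'a::complex_banach"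
  using scaleC_of_real[of 1 x] by simp

lemma scaleC_zero_left [simp]: "0 *\<^sub>C x = 0"
  for x :: "'a::complex_banach"
  using scaleC_of_real[of 0 x] by simp

lemma scaleC_zero_right [simp]: "a *\<^sub>C 0 = (0 :: 'a::complex_banach)"
  using norm_scaleC[of a "0::'a"] by simp

lemma scaleC_minus_left: "(- a) *\<^sub>C x = - (a *\<^sub>C x)"
  for x :: "'a::complex_banach"
  using scaleC_add_left[of "- a" a x] by (simp add: eq_neg_iff_add_eq_0)

lemma scaleC_minus_right: "a *\<^sub>C (- x) = - (a *\<^sub>C x)"
  for x :: "'a::complex_banach"
  using scaleC_add_right[of a "- x" x] by (simp add: eq_neg_iff_add_eq_0)

lemma scaleC_diff_left: "(a - b) *\<^sub>C x = a *\<^sub>C x - b *\<^sub>C x"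
  for x :: "'a::complex_banach"
  using scaleC_add_left[of a "- b" x] by (simp add: scaleC_minus_left)

lemma scaleC_diff_right: "a *\<^sub>C (x - y) = a *\<^sub>C x - a *\<^sub>C y"
  for x :: "'a::complex_banach"
  using scaleC_add_right[of a x "- y"] by (simp add: scaleC_minus_right)

lemma scaleC_sum_right: "a *\<^sub>C (\<Sum>i\<in>A. f i) = (\<Sum>i\<in>A. a *\<^sub>C f i)"
  for f :: "'i \<Rightarrow> 'a::complex_banach"
  by (induction A rule: infinite_finite_induct) (auto simp: scaleC_add_right)

lemma scaleC_cancel: "a *\<^sub>C x = 0 \<longleftrightarrow> a = 0 \<or> x = 0"
  for x :: "'a::complex_banach"
  by (metis norm_eq_zero norm_scaleC mult_eq_0_iff)

lemma bounded_linear_scaleC: "bounded_linear (\<lambda>x::'a::complex_banach. a *\<^sub>C x)"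
proof (rule bounded_linear_intro)
  fix r :: real and x y :: 'a
  show "a *\<^sub>C (x + y) = a *\<^sub>C x + a *\<^sub>C y"
    by (rule scaleC_add_right)
  show "a *\<^sub>C (r *\<^sub>R x) = r *\<^sub>R (a *\<^sub>C x)"
    by (metis scaleC_of_real scaleC_scaleC mult.commute)
  show "norm (a *\<^sub>C x) \<le> norm x * cmod a"
    by (simp add: norm_scaleC mult.commute)
qed


section \<open>Bounded operators, resolvent and spectrum\<close>

definition bounded_clinear :: "('a::complex_banach \<Rightarrow> 'a) \<Rightarrow> bool"
  where "bounded_clinear T \<longleftrightarrow> bounded_linear T \<and> (\<forall>c x. T (c *\<^sub>C x) = c *\<^sub>C T x)"

text \<open>
  The function inverse is only meaningful for bijective \<open>\<zeta> - T\<close>; for algebraic \<open>T\<close> and \<open>\<zeta>\<close> not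
  a zero of the minimal polynomial this is guaranteed by \<open>resolvent_inverse\<close> below.
\<close>

definition resolvent :: "complex \<Rightarrow> ('a::complex_banach \<Rightarrow> 'a) \<Rightarrow> 'a \<Rightarrow> 'a"
  where "resolvent \<zeta> T = inv (\<lambda>x. \<zeta> *\<^sub>C x - T x)"

definition spectrum :: "('a::complex_banach \<Rightarrow> 'a) \<Rightarrow> complex set"
  where "spectrum T = {\<zeta>. \<nexists>S. bounded_clinear S \<and> S \<circ> (\<lambda>x. \<zeta> *\<^sub>C x - T x) = id \<and>
                              (\<lambda>x. \<zeta> *\<^sub>C x - T x) \<circ> S = id}"


section \<open>Polynomials of an operator and the minimal polynomial\<close>

definition poly_op :: "complex poly \<Rightarrow> ('a::complex_banach \<Rightarrow> 'a) \<Rightarrow> 'a \<Rightarrow> 'a"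
  where "poly_op p T x = (\<Sum>i\<le>degree p. coeff p i *\<^sub>C (T ^^ i) x)"

definition algebraic_op :: "('a::complex_banach \<Rightarrow> 'a) \<Rightarrow> bool"
  where "algebraic_op T \<longleftrightarrow> (\<exists>p. p \<noteq> 0 \<and> poly_op p T = (\<lambda>_. 0))"

definition is_minimal_poly :: "('a::complex_banach \<Rightarrow> 'a) \<Rightarrow> complex poly \<Rightarrow> bool"
  where "is_minimal_poly T m \<longleftrightarrow> lead_coeff m = 1 \<and> poly_op m T = (\<lambda>_. 0) \<and>
           (\<forall>p. p \<noteq> 0 \<and> poly_op p T = (\<lambda>_. 0) \<longrightarrow> degree m \<le> degree p)"

definition power_bounded_ops :: "nat \<Rightarrow> real \<Rightarrow> ('a::complex_banach \<Rightarrow> 'a) set"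
  where "power_bounded_ops n C =
           {T. bounded_clinear T \<and> algebraic_op T \<and>
               (\<forall>m. is_minimal_poly T m \<longrightarrow> degree m \<le> n) \<and> (\<forall>k. onorm (T ^^ k) \<le> C)}"


section \<open>Well-definedness of the minimal polynomial and the resolvent\<close>

lemma bounded_clinearD:
  assumes "bounded_clinear T"
  shows "T (x + y) = T x + T y" "T (x - y) = T x - T y" "T 0 = 0" "T (c *\<^sub>C x) = c *\<^sub>C T x"
    "T (- x) = - T x"
    "T (\<Sum>i\<in>A. f i) = (\<Sum>i\<in>A. T (f i))"
  using assms unfolding bounded_clinear_def
  by (auto simp: linear_simps linear_sum bounded_linear.linear)

lemma bounded_clinear_id: "bounded_clinear (\<lambda>x. x)"
  by (auto simp: bounded_clinear_def)

lemma bounded_clinear_funpow: "bounded_clinear T \<Longrightarrow> bounded_clinear (T ^^ k)"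
proof (induction k)
  case 0
  then show ?case by (simp add: bounded_clinear_id id_def)
next
  case (Suc k)
  then show ?case
    unfolding bounded_clinear_def o_def funpow.simps
    using bounded_linear_compose by auto
qed

lemma bounded_clinear_poly_op:
  assumes "bounded_clinear T"
  shows "bounded_clinear (poly_op p T)"
proof -
  have *: "bounded_clinear (T ^^ i)" for i
    by (rule bounded_clinear_funpow[OF assms])
  have "bounded_linear (\<lambda>x. \<Sum>i\<le>degree p. coeff p i *\<^sub>C (T ^^ i) x)"
    using * unfolding bounded_clinear_def
    by (intro bounded_linear_sum bounded_linear_compose[OF bounded_linear_scaleC]) auto
  then show ?thesis
    unfolding bounded_clinear_def poly_op_def
    using * by (auto simp: bounded_clinear_def scaleC_sum_right scaleC_scaleC mult.commute)
qed

lemma poly_op_upto: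
  assumes "degree p \<le> N"
  shows "poly_op p T x = (\<Sum>i\<le>N. coeff p i *\<^sub>C (T ^^ i) x)"
  unfolding poly_op_def
  by (rule sum.mono_neutral_left) (use assms in \<open>auto simp: coeff_eq_0\<close>)

lemma poly_op_0 [simp]: "poly_op 0 T x = 0"
  by (simp add: poly_op_def)

lemma poly_op_add: "poly_op (p + q) T x = poly_op p T x + poly_op q T x"
proof -
  let ?N = "max (degree p) (degree q)"
  show ?thesis
    by (simp add: poly_op_upto[of _ ?N] degree_add_le scaleC_add_left sum.distrib)
qed

lemma poly_op_smult: "poly_op (smult c p) T x = c *\<^sub>C poly_op p T x"
  by (simp add: poly_op_upto[of _ "degree p"] scaleC_sum_right scaleC_scaleC)

lemma poly_op_pCons:
  assumes "bounded_clinear T"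
  shows "poly_op (pCons a p) T x = a *\<^sub>C x + T (poly_op p T x)"
proof -
  have "poly_op (pCons a p) T x = (\<Sum>i\<le>Suc (degree p). coeff (pCons a p) i *\<^sub>C (T ^^ i) x)"
    by (rule poly_op_upto) (simp add: degree_pCons_le)
  also have "\<dots> = a *\<^sub>C x + (\<Sum>i\<le>degree p. coeff p i *\<^sub>C T ((T ^^ i) x))"
    by (subst sum.atMost_Suc_shift) simp
  also have "\<dots> = a *\<^sub>C x + T (poly_op p T x)"
    by (simp add: poly_op_def bounded_clinearD[OF assms])
  finally show ?thesis .
qed

lemma poly_op_mult:
  assumes "bounded_clinear T"
  shows "poly_op (p * q) T x = poly_op p T (poly_op q T x)"
proof (induction p)
  case 0
  then show ?case by simp
next
  case (pCons a p)
  then show ?case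
    by (simp add: mult_pCons_left poly_op_add poly_op_smult poly_op_pCons[OF assms])
qed

lemma minimal_poly_ex1:
  assumes "bounded_clinear T" "algebraic_op T"
  shows "\<exists>!m. is_minimal_poly T m"
proof -
  let ?A = "\<lambda>p. p \<noteq> 0 \<and> poly_op p T = (\<lambda>_. 0)"
  obtain p where p: "?A p" and p_min: "\<And>q. ?A q \<Longrightarrow> degree p \<le> degree q"
    using assms(2) ex_has_least_nat[of ?A _ degree] unfolding algebraic_op_def by metis
  have smult: "poly_op (smult c p) T = (\<lambda>_. 0)" for c
    using p by (simp add: fun_eq_iff poly_op_smult)
  show ?thesis
  proof (rule ex1I)
    show "is_minimal_poly T (smult (inverse (lead_coeff p)) p)"
      using p p_min smult by (auto simp: is_minimal_poly_def)
  next
    fix m assume m: "is_minimal_poly T m"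
    let ?p = "smult (inverse (lead_coeff p)) p"
    have mA: "?A m" using m by (auto simp: is_minimal_poly_def)
    have deg: "degree m = degree ?p"
      using m p p_min[OF mA] by (auto simp: is_minimal_poly_def intro: antisym)
    have "poly_op (m - ?p) T x = 0" for x
      using mA smult[of "- inverse (lead_coeff p)"] poly_op_add[of m "- ?p" T x] by simp
    moreover have "degree (m - ?p) < degree ?p" if "m \<noteq> ?p"
    proof -
      have "degree (m - ?p) \<le> degree ?p" using deg by (simp add: degree_diff_le)
      moreover have "coeff (m - ?p) (degree ?p) = 0"
        using m p deg by (auto simp: is_minimal_poly_def)
      ultimately show ?thesis
        using that
        by (metis eq_zero_or_degree_less right_minus_eq)
    qed
    ultimately show "m = ?p"
    proof -
      assume z: "\<And>x. poly_op (m - ?p) T x = 0"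
        and less: "m \<noteq> ?p \<Longrightarrow> degree (m - ?p) < degree ?p"
      show "m = ?p"
      proof (rule ccontr)
        assume ne: "m \<noteq> ?p"
        have "poly_op (m - ?p) T = (\<lambda>_. 0)" using z by (rule ext)
        then have "degree p \<le> degree (m - ?p)" using ne by (intro p_min) simp
        also have "\<dots> < degree ?p" using ne by (rule less)
        also have "\<dots> = degree p" using p by simp
        finally show False by simp
      qed
    qed
  qed
qed

lemma inverse_off_zeros:
  assumes T: "bounded_clinear T" and m: "is_minimal_poly T m" and \<zeta>: "poly m \<zeta> \<noteq> 0"
  obtains S where "bounded_clinear S" "S \<circ> (\<lambda>x. \<zeta> *\<^sub>C x - T x) = id"
    "(\<lambda>x. \<zeta> *\<^sub>C x - T x) \<circ> S = id"
proof -
  define q where "q = synthetic_div m \<zeta>"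
  define S where "S = poly_op (smult (inverse (poly m \<zeta>)) q) T"
  define L where "L = [:\<zeta>, -1:]"
  have "[:- \<zeta>, 1:] * q = m - [:poly m \<zeta>:]"
    unfolding q_def eq_diff_eq by (rule synthetic_div_correct')
  moreover have "L * q = - ([:- \<zeta>, 1:] * q)"
    by (simp add: L_def)
  ultimately have eq: "L * q = [:poly m \<zeta>:] - m"
    by (simp only: minus_diff_eq)
  have L: "poly_op L T x = \<zeta> *\<^sub>C x - T x" for x
    by (simp add: L_def poly_op_pCons[OF T] bounded_clinearD[OF T] scaleC_minus_left)
  have m0: "poly_op (- m) T x = 0" for x
    using m poly_op_smult[of "-1" m T x] by (simp add: is_minimal_poly_def)
  have one: "poly_op (L * smult (inverse (poly m \<zeta>)) q) T x = x" for x
  proof -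
    have "poly_op (L * q) T x = poly m \<zeta> *\<^sub>C x"
      using poly_op_add[of "[:poly m \<zeta>:]" "- m" T x] m0[of x]
      by (simp add: eq poly_op_pCons[OF T] bounded_clinearD[OF T])
    then show ?thesis using \<zeta> by (simp add: poly_op_smult scaleC_scaleC)
  qed
  show ?thesis
  proof
    show "bounded_clinear S" unfolding S_def by (rule bounded_clinear_poly_op[OF T])
    show "S \<circ> (\<lambda>x. \<zeta> *\<^sub>C x - T x) = id"
    proof
      fix x
      have "S (poly_op L T x) = poly_op (smult (inverse (poly m \<zeta>)) q * L) T x"
        unfolding S_def by (rule poly_op_mult[OF T, symmetric])
      then show "(S \<circ> (\<lambda>x. \<zeta> *\<^sub>C x - T x)) x = id x"
        using one[of x] by (simp only: o_apply L id_apply mult.commute)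
    qed
    show "(\<lambda>x. \<zeta> *\<^sub>C x - T x) \<circ> S = id"
    proof
      fix x
      have "poly_op L T (S x) = poly_op (L * smult (inverse (poly m \<zeta>)) q) T x"
        unfolding S_def by (rule poly_op_mult[OF T, symmetric])
      then show "((\<lambda>x. \<zeta> *\<^sub>C x - T x) \<circ> S) x = id x"
        using one[of x] by (simp only: o_apply L id_apply)
    qed
  qed
qed

lemma spectrum_eq_zeros:
  assumes T: "bounded_clinear T" and m: "is_minimal_poly T m"
  shows "spectrum T = {\<zeta>. poly m \<zeta> = 0}"
proof (intro equalityI subsetI)
  fix \<zeta> assume "\<zeta> \<in> spectrum T"
  then show "\<zeta> \<in> {\<zeta>. poly m \<zeta> = 0}"
    unfolding spectrum_def using inverse_off_zeros[OF T m, of \<zeta>] by blast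
next
  fix \<zeta> assume "\<zeta> \<in> {\<zeta>. poly m \<zeta> = 0}"
  then obtain q where q: "m = [:- \<zeta>, 1:] * q"
    by (auto simp: poly_eq_0_iff_dvd)
  have m0: "m \<noteq> 0" using m by (auto simp: is_minimal_poly_def)
  then have q0: "q \<noteq> 0" and deg: "degree m = Suc (degree q)"
    using q by (auto simp: degree_mult_eq simp del: mult_pCons_left)
  show "\<zeta> \<in> spectrum T"
  proof (rule ccontr)
    assume "\<zeta> \<notin> spectrum T"
    then obtain S where S: "bounded_clinear S" "S \<circ> (\<lambda>x. \<zeta> *\<^sub>C x - T x) = id"
      by (auto simp: spectrum_def)
    have "poly_op q T x = 0" for x
    proof -
      have "T (poly_op q T x) - \<zeta> *\<^sub>C poly_op q T x = poly_op m T x"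
        unfolding q poly_op_mult[OF T]
        by (simp add: poly_op_pCons[OF T] bounded_clinearD[OF T] scaleC_minus_left)
      also have "\<dots> = 0" using m by (simp add: is_minimal_poly_def)
      finally have "\<zeta> *\<^sub>C poly_op q T x - T (poly_op q T x) = 0" by simp
      then show ?thesis
        using fun_cong[OF S(2), of "poly_op q T x"] bounded_clinearD(3)[OF S(1)] by simp
    qed
    then have "degree m \<le> degree q" using m q0 by (auto simp: is_minimal_poly_def)
    then show False using deg by simp
  qed
qed

lemma resolvent_inverse:
  assumes T: "bounded_clinear T" and m: "is_minimal_poly T m" and \<zeta>: "poly m \<zeta> \<noteq> 0"
  shows "bounded_clinear (resolvent \<zeta> T)"
    and "resolvent \<zeta> T (\<zeta> *\<^sub>C x - T x) = x"
    and "\<zeta> *\<^sub>C resolvent \<zeta> T x - T (resolvent \<zeta> T x) = x"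
proof -
  obtain S where S: "bounded_clinear S" "S \<circ> (\<lambda>x. \<zeta> *\<^sub>C x - T x) = id"
    "(\<lambda>x. \<zeta> *\<^sub>C x - T x) \<circ> S = id"
    using inverse_off_zeros[OF assms] by blast
  have "resolvent \<zeta> T = S"
    unfolding resolvent_def by (rule inv_unique_comp[OF S(3,2)])
  then show "bounded_clinear (resolvent \<zeta> T)"
    and "resolvent \<zeta> T (\<zeta> *\<^sub>C x - T x) = x"
    and "\<zeta> *\<^sub>C resolvent \<zeta> T x - T (resolvent \<zeta> T x) = x"
    using S(1) fun_cong[OF S(2), of x] fun_cong[OF S(3), of x] by simp_all
qed

end

theory Submission
  imports Defs
begin

text \<open>
  If \<open>f\<close> is a power series with \<open>(\<zeta> - z) f(z) = 1\<close> modulo the minimal polynomial, then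
  \<open>f(T)\<close> is the resolvent at \<open>\<zeta>\<close>, and its norm is at most \<open>C\<close> times the sum of the moduli of
  the coefficients of \<open>f\<close>. The bounds come from good choices of \<open>f\<close>, or of functions approximating it
  on the spectrum.

  For \<open>\<bar>\<zeta>\<bar> \<le> 1\<close> take a radius \<open>\<rho> > 1\<close> and let \<open>B\<close> be the Blaschke product, for the disk of radius
  \<open>\<rho>\<close>, with the zeros of the minimal polynomial. Since \<open>B(T) = 0\<close>, the function
  \<open>f(z) = (1 - B(z) / B(\<zeta>)) / (\<zeta> - z)\<close> qualifies. Its Hardy norm on the circle of radius \<open>\<rho>\<close> is
  explicit, its square being \<open>(\<bar>B(\<zeta>)\<bar>\<^sup>-\<^sup>2 - 1) / (\<rho>\<^sup>2 - \<bar>\<zeta>\<bar>\<^sup>2)\<close>, and the Cauchy-Schwarz inequality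
  turns it into a bound on the sum of the moduli of the coefficients at the cost of the factor
  \<open>\<rho>\<^sup>2 / (\<rho>\<^sup>2 - 1)\<close> under the root. This is \<open>power_bounded_lower_bound\<close>. The excess
  \<open>\<rho>\<^sup>2 - 1\<close> is then chosen as \<open>1 / N\<close> for the inverse of \<open>T\<close>, and as \<open>d / N\<close> for \<open>\<zeta>\<close> in the disk or on
  the circle, where \<open>d\<close> is the least value of \<open>\<bar>1 - cnj \<mu>\<^sub>i \<zeta>\<bar>\<close>. With this choice the enlargement of
  the disk costs only a constant power of \<open>e\<close> in \<open>\<bar>B(\<zeta>)\<bar>\<^sup>-\<^sup>2\<close>.

  The function \<open>f\<close> is handled through its coefficients: multiplication by a Blaschke factor is the
  recursion of a lossless linear system, so the Hardy norm is a telescoping sum, and the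
  identity \<open>(\<zeta> - T) f(T) = 1\<close> is built up one zero at a time (\<open>blaschke_difference_quotient\<close>).

  When the whole spectrum lies on the unit circle, \<open>T\<close> is diagonalizable because a Jordan block
  there would have unbounded powers. A function of \<open>T\<close> with values \<open>f\<^sub>i\<close> on the spectrum is then the
  limit of averages of \<open>p\<^sub>k T\<^sup>k\<close> with the trigonometric sums \<open>p\<^sub>k = \<Sum>\<^sub>j f\<^sub>j (cnj \<mu>\<^sub>j)\<^sup>k\<close>. The mean square of
  \<open>p\<close> is the sum of the \<open>\<bar>f\<^sub>j\<bar>\<^sup>2\<close>, which gives the factor \<open>sqrt N\<close> (\<open>unimodular_multiplier_bound\<close>).

  The bounds are first shown in the form \<open>norm y \<le> B * norm (\<zeta> y - T y)\<close>, which applied to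
  \<open>y = (\<zeta> - T)\<^sup>-\<^sup>1 x\<close> bounds the resolvent.
\<close>

section \<open>Operators with bounded powers\<close>

lemma poly_op_commute:
  assumes "bounded_clinear A"
  shows "poly_op p A (A x) = A (poly_op p A x)"
proof -
  have X: "poly_op [:0, 1:] A x = A x" for x
    by (simp add: poly_op_pCons[OF assms] bounded_clinearD[OF assms])
  show ?thesis
    by (metis X assms mult.commute poly_op_mult)
qed

lemma poly_op_linear_factor:
  assumes "bounded_clinear A"
  shows "poly_op [:a, b:] A x = a *\<^sub>C x + b *\<^sub>C A x"
  by (simp add: poly_op_pCons[OF assms] bounded_clinearD[OF assms])

lemma funpow_eigenvector:
  assumes "bounded_clinear A" "A x = l *\<^sub>C x"
  shows "(A ^^ k) x = l ^ k *\<^sub>C x"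
  by (induction k) (simp_all add: assms bounded_clinearD[OF assms(1)] scaleC_scaleC mult.commute)

text \<open>
  A vector \<open>x\<close> with \<open>x = l A x\<close> satisfies \<open>x = l\<^sup>k A\<^sup>k x\<close> for every \<open>k\<close>, and the right-hand side tends to
  zero.
\<close>

lemma injective_one_minus_contraction:
  assumes A: "bounded_clinear A" and pow: "\<And>k x. norm ((A ^^ k) x) \<le> C * \<theta> ^ k * norm x"
    and \<theta>: "0 \<le> \<theta>" "\<theta> < 1" and l: "cmod l < 1" and z: "x - l *\<^sub>C A x = 0"
  shows "x = 0"
proof (cases "l = 0")
  case True
  then show ?thesis using z by simp
next
  case False
  then have "A x = (1 / l) *\<^sub>C x"
    using z by (metis eq_iff_diff_eq_0 nonzero_eq_divide_eq scaleC_one scaleC_scaleC)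
  then have "(A ^^ k) x = (1 / l) ^ k *\<^sub>C x" for k
    by (rule funpow_eigenvector[OF A])
  then have "cmod (1 / l) ^ k * norm x \<le> C * \<theta> ^ k * norm x" for k
    using pow[of k x] by (simp add: norm_scaleC norm_power)
  then have *: "norm x \<le> (C * norm x) * (cmod l * \<theta>) ^ k" for k
    using False by (simp add: field_simps norm_divide power_divide power_mult_distrib)
  have "cmod l * \<theta> < 1"
    using l \<theta> by (metis mult_le_one mult_left_le norm_ge_zero order_less_imp_le order_le_less_trans)
  then have "(\<lambda>k. (C * norm x) * (cmod l * \<theta>) ^ k) \<longlonglongrightarrow> (C * norm x) * 0"
    using \<theta> by (intro tendsto_mult tendsto_const LIMSEQ_power_zero) auto
  from LIMSEQ_le_const[OF this, of "norm x"] * have "norm x \<le> 0" by auto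
  then show ?thesis by simp
qed

text \<open>
  This product is the denominator of the Blaschke product. Its injectivity allows it to be
  cancelled from identities proved with denominators cleared.
\<close>

lemma injective_poly_op_prod:
  assumes A: "bounded_clinear A" and pow: "\<And>k x. norm ((A ^^ k) x) \<le> C * \<theta> ^ k * norm x"
    and \<theta>: "0 \<le> \<theta>" "\<theta> < 1" and "finite S" and l: "\<And>i. i \<in> S \<Longrightarrow> cmod (l i) < 1"
    and z: "poly_op (\<Prod>i\<in>S. [:1, - cnj (l i):]) A x = 0"
  shows "x = 0"
  using \<open>finite S\<close> l z
proof (induction S)
  case empty
  then show ?case using poly_op_linear_factor[OF A, of 1 0 x] by (simp add: one_pCons)
next
  case (insert a S)
  let ?u = "poly_op (\<Prod>i\<in>S. [:1, - cnj (l i):]) A x"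
  have "?u - cnj (l a) *\<^sub>C A ?u = poly_op [:1, - cnj (l a):] A ?u"
    by (simp only: poly_op_linear_factor[OF A] scaleC_one scaleC_minus_left) simp
  also have "\<dots> = 0"
    using insert.prems(2) by (simp only: prod.insert[OF insert.hyps] poly_op_mult[OF A])
  finally have "?u = 0"
    by (rule injective_one_minus_contraction[OF A pow \<theta>, rotated]) (use insert.prems in simp)
  then show ?case using insert by simp
qed


section \<open>Difference quotients of Blaschke products\<close>

text \<open>
  If \<open>g\<close> is a power series and \<open>v\<close> solves \<open>(1 - cnj l z) v(z) = (z - l) g(z) + c\<close>, then the coefficients
  of \<open>v\<close> are the output of a linear system with input \<open>g\<close> whose state is \<open>s\<^sub>k = v\<^sub>k + l g\<^sub>k\<close>. So \<open>v\<close> is \<open>g\<close>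
  times the Blaschke factor of \<open>l\<close>, plus a multiple of the reproducing kernel at \<open>l\<close>. The initial
  state is the free parameter \<open>c\<close>.
\<close>

primrec blaschke_state :: "complex \<Rightarrow> complex \<Rightarrow> (nat \<Rightarrow> complex) \<Rightarrow> nat \<Rightarrow> complex" where
  "blaschke_state l c g 0 = c"
| "blaschke_state l c g (Suc k) = cnj l * blaschke_state l c g k + (1 - l * cnj l) * g k"

definition blaschke_step :: "complex \<Rightarrow> complex \<Rightarrow> (nat \<Rightarrow> complex) \<Rightarrow> nat \<Rightarrow> complex" where
  "blaschke_step l c g k = blaschke_state l c g k - l * g k"

lemma blaschke_step_rec:
  "blaschke_step l c g 0 = c - l * g 0"
  "blaschke_step l c g (Suc k) = cnj l * blaschke_step l c g k + g k - l * g (Suc k)"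
  by (simp_all add: blaschke_step_def algebra_simps)

text \<open>
  After the state is divided by \<open>sqrt (1 - \<bar>l\<bar>\<^sup>2)\<close>, the map from (state, input) to (next state, output)
  is a unitary matrix.
\<close>

lemma lossless_step:
  fixes l s g :: complex
  assumes "cmod l < 1"
  shows "(cmod (cnj l * s + (1 - l * cnj l) * g))\<^sup>2 / (1 - (cmod l)\<^sup>2) + (cmod (s - l * g))\<^sup>2
       = (cmod s)\<^sup>2 / (1 - (cmod l)\<^sup>2) + (cmod g)\<^sup>2"
proof -
  have pos: "1 - (cmod l)\<^sup>2 > 0"
    using assms by (simp add: power_less_one_iff abs_square_less_1)
  have "complex_of_real ((cmod (cnj l * s + (1 - l * cnj l) * g))\<^sup>2
      + (1 - (cmod l)\<^sup>2) * (cmod (s - l * g))\<^sup>2)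
      = complex_of_real ((cmod s)\<^sup>2 + (1 - (cmod l)\<^sup>2) * (cmod g)\<^sup>2)"
    unfolding of_real_add of_real_mult of_real_diff complex_norm_square
    by (simp add: algebra_simps)
  then have "(cmod (cnj l * s + (1 - l * cnj l) * g))\<^sup>2 + (1 - (cmod l)\<^sup>2) * (cmod (s - l * g))\<^sup>2
      = (cmod s)\<^sup>2 + (1 - (cmod l)\<^sup>2) * (cmod g)\<^sup>2"
    by (simp only: of_real_eq_iff)
  then show ?thesis using pos by (simp add: divide_simps) (simp add: algebra_simps)
qed

text \<open>
  Summing the energy balance telescopes, and the energy left in the final state is dropped. In the
  limit this is the Pythagorean identity for the orthogonal splitting into a multiple of the Blaschke
  factor and a multiple of the reproducing kernel.
\<close>

lemma energy_blaschke_step: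
  assumes "cmod l < 1"
  shows "(\<Sum>k<K. (cmod (blaschke_step l c g k))\<^sup>2)
       \<le> (\<Sum>k<K. (cmod (g k))\<^sup>2) + (cmod c)\<^sup>2 / (1 - (cmod l)\<^sup>2)"
proof -
  have "(\<Sum>k<K. (cmod (blaschke_step l c g k))\<^sup>2) + (cmod (blaschke_state l c g K))\<^sup>2 / (1 - (cmod l)\<^sup>2)
      = (\<Sum>k<K. (cmod (g k))\<^sup>2) + (cmod c)\<^sup>2 / (1 - (cmod l)\<^sup>2)"
  proof (induction K)
    case (Suc K)
    then show ?case
      using lossless_step[OF assms, of "blaschke_state l c g K" "g K"]
      by (simp add: blaschke_step_def)
  qed simp
  moreover have "(cmod (blaschke_state l c g K))\<^sup>2 / (1 - (cmod l)\<^sup>2) \<ge> 0"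
    using assms by (simp add: abs_square_le_1)
  ultimately show ?thesis by linarith
qed

lemma one_minus_cnj_mult_nonzero:
  assumes "cmod l < 1" "cmod w < 1"
  shows "1 - cnj l * w \<noteq> 0"
proof -
  have "cmod (cnj l * w) < 1"
    using assms by (simp add: norm_mult) (metis mult_left_le norm_ge_zero order_less_imp_le order_le_less_trans)
  then show ?thesis by auto
qed

lemma one_minus_blaschke_factor:
  assumes nz: "1 - cnj l * w \<noteq> 0"
  shows "1 - (cmod ((w - l) / (1 - cnj l * w)))\<^sup>2
       = (1 - (cmod l)\<^sup>2) * (1 - (cmod w)\<^sup>2) / (cmod (1 - cnj l * w))\<^sup>2"
proof -
  have "complex_of_real ((cmod (1 - cnj l * w))\<^sup>2 - (cmod (w - l))\<^sup>2)
      = complex_of_real ((1 - (cmod l)\<^sup>2) * (1 - (cmod w)\<^sup>2))"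
    unfolding of_real_mult of_real_diff complex_norm_square by (simp add: algebra_simps)
  then have "(cmod (1 - cnj l * w))\<^sup>2 - (cmod (w - l))\<^sup>2 = (1 - (cmod l)\<^sup>2) * (1 - (cmod w)\<^sup>2)"
    by (simp only: of_real_eq_iff)
  then show ?thesis using nz by (simp add: norm_divide power_divide divide_simps)
qed

lemma norm_le_sqrt_energy:
  fixes h :: "nat \<Rightarrow> complex"
  assumes "\<And>K. (\<Sum>k<K. (cmod (h k))\<^sup>2) \<le> E"
  shows "cmod (h k) \<le> sqrt E"
proof (rule real_le_rsqrt)
  have "(cmod (h k))\<^sup>2 \<le> (\<Sum>k<Suc k. (cmod (h k))\<^sup>2)"
    by (rule member_le_sum[of k]) auto
  also have "\<dots> \<le> E" by (rule assms)
  finally show "(cmod (h k))\<^sup>2 \<le> E" .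
qed

lemma summable_operator_series:
  fixes A :: "'a::complex_banach \<Rightarrow> 'a"
  assumes pow: "\<And>k x. norm ((A ^^ k) x) \<le> C * \<theta> ^ k * norm x" and "0 \<le> \<theta>" "\<theta> < 1"
    and f: "\<And>k. cmod (f k) \<le> M"
  shows "summable (\<lambda>k. f k *\<^sub>C (A ^^ k) x)"
proof (rule summable_comparison_test')
  show "summable (\<lambda>k. (M * (C * norm x)) * \<theta> ^ k)"
    using assms by (intro summable_mult summable_geometric) auto
  have M: "0 \<le> M" using f[of 0] norm_ge_zero order_trans by blast
  show "norm (f k *\<^sub>C (A ^^ k) x) \<le> (M * (C * norm x)) * \<theta> ^ k" for k
    using mult_mono[OF f[of k] pow[of k x] M] by (simp add: norm_scaleC mult_ac)
qed

text \<open>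
  Substituting \<open>A\<close> into \<open>(1 - cnj l z) v(z) = (z - l) g(z) + c\<close>.
\<close>

lemma operator_series_blaschke_step:
  fixes A :: "'a::complex_banach \<Rightarrow> 'a"
  assumes A: "bounded_clinear A"
    and sv: "summable (\<lambda>k. blaschke_step l c g k *\<^sub>C (A ^^ k) x)" (is "summable ?v")
    and sg: "summable (\<lambda>k. g k *\<^sub>C (A ^^ k) x)" (is "summable ?g")
  shows "suminf ?v - cnj l *\<^sub>C A (suminf ?v) = A (suminf ?g) - l *\<^sub>C suminf ?g + c *\<^sub>C x"
proof -
  let ?w = "blaschke_step l c g"
  have bl: "bounded_linear A" using A by (simp add: bounded_clinear_def)
  have shift: "(\<lambda>k. a *\<^sub>C A (h k *\<^sub>C (A ^^ k) x)) sums (a *\<^sub>C A (suminf (\<lambda>k. h k *\<^sub>C (A ^^ k) x)))"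
    if "summable (\<lambda>k. h k *\<^sub>C (A ^^ k) x)" for a h
    by (intro bounded_linear.sums[OF bounded_linear_scaleC] bounded_linear.sums[OF bl]
        summable_sums that)
  have tail: "(\<lambda>k. h (Suc k) *\<^sub>C (A ^^ Suc k) x) sums (suminf (\<lambda>k. h k *\<^sub>C (A ^^ k) x) - h 0 *\<^sub>C x)"
    if "summable (\<lambda>k. h k *\<^sub>C (A ^^ k) x)" for h
    using summable_sums[OF that] by (subst sums_Suc_iff) simp
  have "(\<lambda>k. cnj l *\<^sub>C A (?v k) + 1 *\<^sub>C A (?g k) - l *\<^sub>C (g (Suc k) *\<^sub>C (A ^^ Suc k) x))
      sums (cnj l *\<^sub>C A (suminf ?v) + 1 *\<^sub>C A (suminf ?g) - l *\<^sub>C (suminf ?g - g 0 *\<^sub>C x))"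
    by (intro sums_diff sums_add shift sv sg
        bounded_linear.sums[OF bounded_linear_scaleC] tail)
  moreover have "cnj l *\<^sub>C A (?v k) + 1 *\<^sub>C A (?g k) - l *\<^sub>C (g (Suc k) *\<^sub>C (A ^^ Suc k) x)
      = ?w (Suc k) *\<^sub>C (A ^^ Suc k) x" for k
    by (simp add: blaschke_step_rec bounded_clinearD[OF A] scaleC_scaleC scaleC_add_left
        scaleC_diff_left)
  ultimately have "(\<lambda>k. ?w (Suc k) *\<^sub>C (A ^^ Suc k) x)
      sums (cnj l *\<^sub>C A (suminf ?v) + 1 *\<^sub>C A (suminf ?g) - l *\<^sub>C (suminf ?g - g 0 *\<^sub>C x))"
    by simp
  from sums_unique2[OF this tail[OF sv]] show ?thesis
    by (simp add: blaschke_step_rec scaleC_diff_left scaleC_diff_right scaleC_scaleC algebra_simps)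
qed

text \<open>
  Here \<open>f\<close> is the coefficient sequence of \<open>(B(w) - B(z)) / (w - z)\<close> for the Blaschke product \<open>B\<close> with
  zeros \<open>l i\<close>. The last conjunct is the defining identity \<open>(w - z) f(z) = B(w) - B(z)\<close> at \<open>z = A\<close>,
  multiplied by the denominator of \<open>B\<close>. The induction rests on
  \<open>b(w) B(w) - b(z) B(z) = b(z) (B(w) - B(z)) + B(w) (b(w) - b(z))\<close>: after division by \<open>w - z\<close> the last
  term is a multiple of the reproducing kernel at the new zero, so one step of the lossless system
  adds one factor.
\<close>

lemma blaschke_difference_quotient:
  fixes A :: "'a::complex_banach \<Rightarrow> 'a"
  assumes A: "bounded_clinear A" and pow: "\<And>k x. norm ((A ^^ k) x) \<le> C * \<theta> ^ k * norm x"
    and \<theta>: "0 \<le> \<theta>" "\<theta> < 1" and w: "cmod w < 1"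
    and "finite S" and l: "\<And>i. i \<in> S \<Longrightarrow> cmod (l i) < 1"
  defines "b \<equiv> \<lambda>i. (w - l i) / (1 - cnj (l i) * w)"
  shows "\<exists>f. (\<forall>K. (\<Sum>k<K. (cmod (f k))\<^sup>2) \<le> (1 - (cmod (\<Prod>i\<in>S. b i))\<^sup>2) / (1 - (cmod w)\<^sup>2)) \<and>
     (\<forall>y. poly_op (\<Prod>i\<in>S. [:1, - cnj (l i):]) A (\<Sum>k. f k *\<^sub>C (A ^^ k) (w *\<^sub>C y - A y))
        = (\<Prod>i\<in>S. b i) *\<^sub>C poly_op (\<Prod>i\<in>S. [:1, - cnj (l i):]) A y
          - poly_op (\<Prod>i\<in>S. [:- l i, 1:]) A y)"
  using \<open>finite S\<close> l
proof (induction S)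
  case empty
  have "poly_op 1 A x = x" for x
    using poly_op_linear_factor[OF A, of 1 0 x] by (simp add: one_pCons)
  then show ?case by (intro exI[of _ "\<lambda>_. 0"]) simp
next
  case (insert a S)
  let ?Q = "poly_op (\<Prod>i\<in>S. [:1, - cnj (l i):]) A"
  let ?P = "poly_op (\<Prod>i\<in>S. [:- l i, 1:]) A"
  let ?\<beta> = "\<Prod>i\<in>S. b i"
  obtain g where g: "\<And>K. (\<Sum>k<K. (cmod (g k))\<^sup>2) \<le> (1 - (cmod ?\<beta>)\<^sup>2) / (1 - (cmod w)\<^sup>2)"
    and G: "\<And>y. ?Q (\<Sum>k. g k *\<^sub>C (A ^^ k) (w *\<^sub>C y - A y)) = ?\<beta> *\<^sub>C ?Q y - ?P y"
    using insert by auto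
  \<comment> \<open>From \<open>(b(w) - b(z)) / (w - z) = (1 - \<bar>l\<bar>\<^sup>2) / ((1 - cnj l w) (1 - cnj l z))\<close>.\<close>
  define c where "c = ?\<beta> * (1 - l a * cnj (l a)) / (1 - cnj (l a) * w)"
  let ?f = "blaschke_step (l a) c g"
  have la: "cmod (l a) < 1" using insert by simp
  note nz = one_minus_cnj_mult_nonzero[OF la w]
  have w1: "1 - (cmod w)\<^sup>2 > 0" and l1: "1 - (cmod (l a))\<^sup>2 > 0"
    using w la by (simp_all add: abs_square_less_1)
  have "1 - l a * cnj (l a) = complex_of_real (1 - (cmod (l a))\<^sup>2)"
    by (simp only: of_real_diff complex_norm_square of_real_1)
  then have "cmod (1 - l a * cnj (l a)) = 1 - (cmod (l a))\<^sup>2"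
    using l1 by (simp only: norm_of_real abs_of_pos)
  then have "(cmod c)\<^sup>2 / (1 - (cmod (l a))\<^sup>2)
      = (cmod ?\<beta>)\<^sup>2 * ((1 - (cmod (l a))\<^sup>2) / (cmod (1 - cnj (l a) * w))\<^sup>2)"
    using l1 by (simp add: c_def norm_mult norm_divide power_mult_distrib power_divide power2_eq_square)
  also have "(1 - (cmod (l a))\<^sup>2) / (cmod (1 - cnj (l a) * w))\<^sup>2
      = (1 - (cmod (b a))\<^sup>2) / (1 - (cmod w)\<^sup>2)"
    using one_minus_blaschke_factor[OF nz] w1 by (simp add: b_def)
  finally have c2: "(cmod c)\<^sup>2 / (1 - (cmod (l a))\<^sup>2)
      = (cmod ?\<beta>)\<^sup>2 * ((1 - (cmod (b a))\<^sup>2) / (1 - (cmod w)\<^sup>2))" .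
  have \<beta>': "(\<Prod>i\<in>insert a S. b i) = b a * ?\<beta>" using insert by simp
  have energy: "(\<Sum>k<K. (cmod (?f k))\<^sup>2) \<le> (1 - (cmod (b a * ?\<beta>))\<^sup>2) / (1 - (cmod w)\<^sup>2)" for K
  proof -
    have "(\<Sum>k<K. (cmod (?f k))\<^sup>2) \<le> (1 - (cmod ?\<beta>)\<^sup>2) / (1 - (cmod w)\<^sup>2)
        + (cmod ?\<beta>)\<^sup>2 * ((1 - (cmod (b a))\<^sup>2) / (1 - (cmod w)\<^sup>2))"
      using energy_blaschke_step[OF la, of c g K] g[of K] c2 by linarith
    also have "\<dots> = (1 - (cmod (b a * ?\<beta>))\<^sup>2) / (1 - (cmod w)\<^sup>2)"
      using w1 by (simp add: norm_mult power_mult_distrib field_simps)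
    finally show ?thesis .
  qed
  have "poly_op (\<Prod>i\<in>insert a S. [:1, - cnj (l i):]) A (\<Sum>k. ?f k *\<^sub>C (A ^^ k) (w *\<^sub>C y - A y))
      = (b a * ?\<beta>) *\<^sub>C poly_op (\<Prod>i\<in>insert a S. [:1, - cnj (l i):]) A y
          - poly_op (\<Prod>i\<in>insert a S. [:- l i, 1:]) A y" for y
  proof -
    define x where "x = w *\<^sub>C y - A y"
    define V where "V = (\<Sum>k. ?f k *\<^sub>C (A ^^ k) x)"
    define G' where "G' = (\<Sum>k. g k *\<^sub>C (A ^^ k) x)"
    define u where "u = ?Q y"
    define v where "v = ?P y"
    have Qlin: "bounded_clinear ?Q" by (rule bounded_clinear_poly_op[OF A])
    have Q_insert: "poly_op (\<Prod>i\<in>insert a S. [:1, - cnj (l i):]) A z = ?Q (z - cnj (l a) *\<^sub>C A z)" for z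
      using insert.hyps poly_op_mult[OF A, of "\<Prod>i\<in>S. [:1, - cnj (l i):]" "[:1, - cnj (l a):]" z]
      by (simp only: prod.insert mult.commute[of "[:1, - cnj (l a):]"] poly_op_linear_factor[OF A]
          scaleC_one scaleC_minus_left) simp
    have P_insert: "poly_op (\<Prod>i\<in>insert a S. [:- l i, 1:]) A y = A v - l a *\<^sub>C v"
      by (simp only: prod.insert[OF insert.hyps] poly_op_mult[OF A] poly_op_linear_factor[OF A] v_def
          scaleC_one scaleC_minus_left) simp
    have "V - cnj (l a) *\<^sub>C A V = A G' - l a *\<^sub>C G' + c *\<^sub>C x"
      unfolding V_def G'_def
      by (rule operator_series_blaschke_step[OF A
            summable_operator_series[OF pow \<theta> norm_le_sqrt_energy[OF energy]]
            summable_operator_series[OF pow \<theta> norm_le_sqrt_energy[OF g]]])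
    then have "?Q (V - cnj (l a) *\<^sub>C A V) = A (?Q G') - l a *\<^sub>C ?Q G' + c *\<^sub>C ?Q x"
      by (simp add: bounded_clinearD[OF Qlin] poly_op_commute[OF A])
    also have "?Q G' = ?\<beta> *\<^sub>C u - v" using G by (simp add: G'_def x_def u_def v_def)
    also have "?Q x = w *\<^sub>C u - A u"
      by (simp add: x_def u_def bounded_clinearD[OF Qlin] poly_op_commute[OF A])
    also have "A (?\<beta> *\<^sub>C u - v) - l a *\<^sub>C (?\<beta> *\<^sub>C u - v) + c *\<^sub>C (w *\<^sub>C u - A u)
        = (?\<beta> - c) *\<^sub>C A u + (c * w - ?\<beta> * l a) *\<^sub>C u - (A v - l a *\<^sub>C v)"
      by (simp add: bounded_clinearD[OF A] scaleC_diff_left scaleC_diff_right scaleC_scaleC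
          mult.commute algebra_simps)
    also have "?\<beta> - c = - (b a * ?\<beta> * cnj (l a))"
      using nz by (simp add: c_def b_def divide_simps) (simp add: algebra_simps)
    also have "c * w - ?\<beta> * l a = b a * ?\<beta>"
      using nz by (simp add: c_def b_def divide_simps) (simp add: algebra_simps)
    also have "(- (b a * ?\<beta> * cnj (l a))) *\<^sub>C A u + (b a * ?\<beta>) *\<^sub>C u - (A v - l a *\<^sub>C v)
        = (b a * ?\<beta>) *\<^sub>C (u - cnj (l a) *\<^sub>C A u) - (A v - l a *\<^sub>C v)"
      by (simp add: scaleC_diff_right scaleC_scaleC scaleC_minus_left)
    also have "u - cnj (l a) *\<^sub>C A u = ?Q (y - cnj (l a) *\<^sub>C A y)"
      by (simp add: u_def bounded_clinearD[OF Qlin] poly_op_commute[OF A])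
    finally show ?thesis
      by (simp only: Q_insert P_insert V_def x_def)
  qed
  then show ?case
    using energy unfolding \<beta>' by blast
qed


text \<open>
  The Cauchy-Schwarz inequality against the geometric sequence \<open>\<theta>\<^sup>k\<close>.
\<close>

lemma norm_operator_series_le:
  fixes A :: "'a::complex_banach \<Rightarrow> 'a"
  assumes pow: "\<And>k x. norm ((A ^^ k) x) \<le> C * \<theta> ^ k * norm x"
    and C: "0 \<le> C" and \<theta>: "0 \<le> \<theta>" "\<theta> < 1"
    and E: "\<And>K. (\<Sum>k<K. (cmod (f k))\<^sup>2) \<le> E"
    and sm: "summable (\<lambda>k. f k *\<^sub>C (A ^^ k) x)"
  shows "norm (\<Sum>k. f k *\<^sub>C (A ^^ k) x) \<le> C * sqrt (E / (1 - \<theta>\<^sup>2)) * norm x"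
proof -
  have \<theta>2: "\<theta>\<^sup>2 < 1" using \<theta> by (simp add: abs_square_less_1)
  have partial: "norm (\<Sum>k<K. f k *\<^sub>C (A ^^ k) x) \<le> C * sqrt (E / (1 - \<theta>\<^sup>2)) * norm x" for K
  proof -
    have "norm (\<Sum>k<K. f k *\<^sub>C (A ^^ k) x) \<le> (\<Sum>k<K. cmod (f k) * (C * \<theta> ^ k * norm x))"
      by (rule sum_norm_le) (simp add: norm_scaleC mult_left_mono pow)
    also have "\<dots> = (C * norm x) * (\<Sum>k<K. cmod (f k) * \<theta> ^ k)"
      by (simp add: sum_distrib_left mult_ac)
    also have "(\<Sum>k<K. cmod (f k) * \<theta> ^ k) \<le> sqrt (E / (1 - \<theta>\<^sup>2))"
    proof (rule real_le_rsqrt)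
      have "(\<Sum>k<K. cmod (f k) * \<theta> ^ k)\<^sup>2 \<le> (\<Sum>k<K. (cmod (f k))\<^sup>2) * (\<Sum>k<K. (\<theta> ^ k)\<^sup>2)"
        by (rule Cauchy_Schwarz_ineq_sum)
      also have "(\<Sum>k<K. (\<theta> ^ k)\<^sup>2) = (\<Sum>k<K. (\<theta>\<^sup>2) ^ k)"
        by (simp add: power_mult[symmetric] mult.commute)
      also have "\<dots> \<le> (\<Sum>k. (\<theta>\<^sup>2) ^ k)"
        using \<theta>2 by (intro sum_le_suminf summable_geometric) auto
      also have "\<dots> = 1 / (1 - \<theta>\<^sup>2)"
        using \<theta>2 by (intro suminf_geometric) auto
      also have "(\<Sum>k<K. (cmod (f k))\<^sup>2) * (1 / (1 - \<theta>\<^sup>2)) \<le> E * (1 / (1 - \<theta>\<^sup>2))"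
        using \<theta>2 by (intro mult_right_mono E) auto
      finally show "(\<Sum>k<K. cmod (f k) * \<theta> ^ k)\<^sup>2 \<le> E / (1 - \<theta>\<^sup>2)"
        by (simp add: mult_left_mono sum_nonneg)
    qed
    finally have "norm (\<Sum>k<K. f k *\<^sub>C (A ^^ k) x) \<le> (C * norm x) * sqrt (E / (1 - \<theta>\<^sup>2))"
      using C by (simp add: mult_left_mono)
    then show ?thesis by (simp add: mult_ac)
  qed
  have "(\<lambda>K. norm (\<Sum>k<K. f k *\<^sub>C (A ^^ k) x)) \<longlonglongrightarrow> norm (\<Sum>k. f k *\<^sub>C (A ^^ k) x)"
    using summable_LIMSEQ[OF sm] by (rule tendsto_norm)
  then show ?thesis by (rule LIMSEQ_le_const2) (use partial in auto)
qed

text \<open>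
  Since \<open>B(A) = 0\<close>, the operator \<open>f(A)\<close> built from the difference quotient satisfies
  \<open>f(A) (w - A) = B(w)\<close>, and its norm is controlled by the energy of \<open>f\<close>.
\<close>

lemma contraction_lower_bound:
  fixes A :: "'a::complex_banach \<Rightarrow> 'a"
  assumes A: "bounded_clinear A" and pow: "\<And>k x. norm ((A ^^ k) x) \<le> C * \<theta> ^ k * norm x"
    and C: "0 \<le> C" and \<theta>: "0 \<le> \<theta>" "\<theta> < 1" and w: "cmod w < 1"
    and S: "finite S" and l: "\<And>i. i \<in> S \<Longrightarrow> cmod (l i) < 1" and wl: "\<And>i. i \<in> S \<Longrightarrow> w \<noteq> l i"
    and ann: "\<And>x. poly_op (\<Prod>i\<in>S. [:- l i, 1:]) A x = 0"
  shows "norm y \<le> C * sqrt (((\<Prod>i\<in>S. (cmod (1 - cnj (l i) * w) / cmod (w - l i))\<^sup>2) - 1)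
      / ((1 - (cmod w)\<^sup>2) * (1 - \<theta>\<^sup>2))) * norm (w *\<^sub>C y - A y)"
proof -
  define \<beta> where "\<beta> = (\<Prod>i\<in>S. (w - l i) / (1 - cnj (l i) * w))"
  let ?Q = "poly_op (\<Prod>i\<in>S. [:1, - cnj (l i):]) A"
  define x where "x = w *\<^sub>C y - A y"
  define E where "E = (1 - (cmod \<beta>)\<^sup>2) / (1 - (cmod w)\<^sup>2)"
  obtain f where f: "\<And>K. (\<Sum>k<K. (cmod (f k))\<^sup>2) \<le> E"
    and F: "\<And>y. ?Q (\<Sum>k. f k *\<^sub>C (A ^^ k) (w *\<^sub>C y - A y))
        = \<beta> *\<^sub>C ?Q y - poly_op (\<Prod>i\<in>S. [:- l i, 1:]) A y"
    using blaschke_difference_quotient[where l = l, OF A pow \<theta> w S l] unfolding \<beta>_def E_def by blast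
  define V where "V = (\<Sum>k. f k *\<^sub>C (A ^^ k) x)"
  have sm: "summable (\<lambda>k. f k *\<^sub>C (A ^^ k) x)"
    by (rule summable_operator_series[OF pow \<theta> norm_le_sqrt_energy[OF f]])
  have Qlin: "bounded_clinear ?Q" by (rule bounded_clinear_poly_op[OF A])
  have "?Q (V - \<beta> *\<^sub>C y) = 0"
    using F[of y] ann[of y] by (simp add: V_def x_def bounded_clinearD[OF Qlin])
  then have "V - \<beta> *\<^sub>C y = 0"
    by (rule injective_poly_op_prod[OF A pow \<theta> S l, rotated])
  then have "V = \<beta> *\<^sub>C y" by simp
  moreover have "norm V \<le> C * sqrt (E / (1 - \<theta>\<^sup>2)) * norm x"
    unfolding V_def by (rule norm_operator_series_le[OF pow C \<theta> f sm])
  ultimately have \<beta>y: "cmod \<beta> * norm y \<le> C * sqrt (E / (1 - \<theta>\<^sup>2)) * norm x"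
    by (simp add: norm_scaleC)
  have nz: "1 - cnj (l i) * w \<noteq> 0" if "i \<in> S" for i
    by (rule one_minus_cnj_mult_nonzero[OF l[OF that] w])
  then have \<beta>0: "\<beta> \<noteq> 0" using wl S by (auto simp: \<beta>_def)
  with \<beta>y have "norm y \<le> C * (sqrt (E / (1 - \<theta>\<^sup>2)) / cmod \<beta>) * norm x"
    by (simp add: pos_le_divide_eq mult.commute)
  also have "sqrt (E / (1 - \<theta>\<^sup>2)) / cmod \<beta> = sqrt (E / (1 - \<theta>\<^sup>2) / (cmod \<beta>)\<^sup>2)"
    by (simp add: real_sqrt_divide real_sqrt_mult)
  also have "E / (1 - \<theta>\<^sup>2) / (cmod \<beta>)\<^sup>2
      = (1 / (cmod \<beta>)\<^sup>2 - 1) / ((1 - (cmod w)\<^sup>2) * (1 - \<theta>\<^sup>2))"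
    using \<beta>0 by (simp add: E_def diff_divide_distrib mult_ac)
  also have "1 / (cmod \<beta>)\<^sup>2 = (\<Prod>i\<in>S. (cmod (1 - cnj (l i) * w) / cmod (w - l i))\<^sup>2)"
    unfolding \<beta>_def prod_norm[symmetric] prod_power_distrib inverse_eq_divide[symmetric]
      prod_inversef[symmetric]
    by (rule prod.cong) (simp_all add: norm_divide power_divide)
  finally show ?thesis by (simp only: x_def)
qed

text \<open>
  The previous estimate for \<open>A = T / \<rho>\<close> with \<open>\<rho>\<^sup>2 = q\<close>. The rescaling moves the spectrum from the closed
  disk into the open one and makes the powers decay like \<open>\<rho>\<close> to the power \<open>-k\<close>.
\<close>

lemma power_bounded_lower_bound:
  fixes T :: "'a::complex_banach \<Rightarrow> 'a"
  assumes T: "bounded_clinear T" and pow: "\<And>k x. norm ((T ^^ k) x) \<le> C * norm x"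
    and C: "0 \<le> C" and q: "1 < q" and \<zeta>: "cmod \<zeta> \<le> 1"
    and S: "finite S" and \<mu>: "\<And>i. i \<in> S \<Longrightarrow> cmod (\<mu> i) \<le> 1" and \<zeta>\<mu>: "\<And>i. i \<in> S \<Longrightarrow> \<zeta> \<noteq> \<mu> i"
    and ann: "\<And>x. poly_op (\<Prod>i\<in>S. [:- \<mu> i, 1:]) T x = 0"
  shows "norm y \<le> C * sqrt (((\<Prod>i\<in>S. (cmod (of_real q - cnj (\<mu> i) * \<zeta>))\<^sup>2 / (q * (cmod (\<zeta> - \<mu> i))\<^sup>2)) - 1)
      * q / ((q - (cmod \<zeta>)\<^sup>2) * (q - 1))) * norm (\<zeta> *\<^sub>C y - T y)"
proof -
  define \<theta> where "\<theta> = 1 / sqrt q"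
  define A where "A = (\<lambda>x. complex_of_real \<theta> *\<^sub>C T x)"
  define w where "w = of_real \<theta> * \<zeta>"
  define l where "l = (\<lambda>i. of_real \<theta> * \<mu> i)"
  have \<theta>: "0 < \<theta>" "\<theta> < 1" using q by (simp_all add: \<theta>_def)
  have \<theta>2: "\<theta>\<^sup>2 = 1 / q" using q by (simp add: \<theta>_def power_divide)
  have A: "bounded_clinear A"
    using T unfolding bounded_clinear_def A_def
    by (auto simp: scaleC_scaleC mult.commute intro: bounded_linear_compose[OF bounded_linear_scaleC])
  have Ak: "(A ^^ k) x = of_real \<theta> ^ k *\<^sub>C (T ^^ k) x" for k x
    by (induction k) (simp_all add: A_def bounded_clinearD[OF T] scaleC_scaleC)
  have Apow: "norm ((A ^^ k) x) \<le> C * \<theta> ^ k * norm x" for k x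
    using mult_left_mono[OF pow[of k x], of "\<theta> ^ k"] \<theta>
    by (simp add: Ak norm_scaleC norm_power mult_ac)
  have small: "cmod (of_real \<theta> * z) < 1" if "cmod z \<le> 1" for z
    using that \<theta> by (simp add: norm_mult) (metis mult_left_le order_le_less_trans order_less_imp_le)
  have poly: "poly_op (\<Prod>i\<in>S. [:- l i, 1:]) A x = of_real \<theta> ^ card S *\<^sub>C poly_op (\<Prod>i\<in>S. [:- \<mu> i, 1:]) T x" for x
    using S
  proof (induction S)
    case empty
    show ?case using poly_op_linear_factor[OF A, of 1 0 x] poly_op_linear_factor[OF T, of 1 0 x]
      by (simp add: one_pCons)
  next
    case (insert a S)
    show ?case
      by (simp only: prod.insert[OF insert.hyps] card_insert_disjoint[OF insert.hyps] poly_op_mult[OF A]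
          poly_op_mult[OF T] poly_op_linear_factor[OF A] poly_op_linear_factor[OF T] insert.IH)
        (simp add: A_def l_def bounded_clinearD[OF T] scaleC_scaleC scaleC_add_right
          scaleC_minus_left scaleC_diff_right mult_ac)
  qed
  have "norm y \<le> C * sqrt (((\<Prod>i\<in>S. (cmod (1 - cnj (l i) * w) / cmod (w - l i))\<^sup>2) - 1)
      / ((1 - (cmod w)\<^sup>2) * (1 - \<theta>\<^sup>2))) * norm (w *\<^sub>C y - A y)"
  proof (rule contraction_lower_bound[OF A Apow C _ \<theta>(2) _ S])
    show "w \<noteq> l i" if "i \<in> S" for i
      using \<zeta>\<mu>[OF that] \<theta> by (simp add: w_def l_def)
    show "poly_op (\<Prod>i\<in>S. [:- l i, 1:]) A x = 0" for x by (simp add: poly ann)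
  qed (use \<theta> \<zeta> \<mu> small in \<open>auto simp: w_def l_def\<close>)
  also have "w *\<^sub>C y - A y = of_real \<theta> *\<^sub>C (\<zeta> *\<^sub>C y - T y)"
    by (simp add: w_def A_def scaleC_diff_right scaleC_scaleC)
  also have "norm \<dots> = sqrt (1 / q) * norm (\<zeta> *\<^sub>C y - T y)"
    using \<theta> by (simp add: norm_scaleC \<theta>2[symmetric])
  also have "(\<Prod>i\<in>S. (cmod (1 - cnj (l i) * w) / cmod (w - l i))\<^sup>2)
      = (\<Prod>i\<in>S. (cmod (of_real q - cnj (\<mu> i) * \<zeta>))\<^sup>2 / (q * (cmod (\<zeta> - \<mu> i))\<^sup>2))"
  proof (rule prod.cong[OF refl])
    fix i assume "i \<in> S"
    have "cnj (l i) * w = of_real (\<theta>\<^sup>2) * (cnj (\<mu> i) * \<zeta>)"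
      by (simp add: l_def w_def power2_eq_square)
    then have "1 - cnj (l i) * w = (of_real q - cnj (\<mu> i) * \<zeta>) / of_real q"
      using q by (simp add: \<theta>2 field_simps)
    then have a: "cmod (1 - cnj (l i) * w) = cmod (of_real q - cnj (\<mu> i) * \<zeta>) / q"
      using q by (simp add: norm_divide)
    have "w - l i = of_real \<theta> * (\<zeta> - \<mu> i)" by (simp add: w_def l_def algebra_simps)
    then have b: "cmod (w - l i) = \<theta> * cmod (\<zeta> - \<mu> i)" using \<theta> by (simp add: norm_mult)
    show "(cmod (1 - cnj (l i) * w) / cmod (w - l i))\<^sup>2
        = (cmod (of_real q - cnj (\<mu> i) * \<zeta>))\<^sup>2 / (q * (cmod (\<zeta> - \<mu> i))\<^sup>2)"
      unfolding a b power_divide power_mult_distrib \<theta>2 using q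
      by (simp add: power2_eq_square)
  qed
  finally have "norm y \<le> C * (sqrt (((\<Prod>i\<in>S. (cmod (of_real q - cnj (\<mu> i) * \<zeta>))\<^sup>2
      / (q * (cmod (\<zeta> - \<mu> i))\<^sup>2)) - 1) / ((1 - (cmod w)\<^sup>2) * (1 - \<theta>\<^sup>2))) * sqrt (1 / q))
      * norm (\<zeta> *\<^sub>C y - T y)" (is "_ \<le> C * (sqrt (?W / _) * _) * _")
    by (simp only: mult.assoc)
  also have "sqrt (?W / ((1 - (cmod w)\<^sup>2) * (1 - \<theta>\<^sup>2))) * sqrt (1 / q)
      = sqrt (?W / ((1 - (cmod w)\<^sup>2) * (1 - \<theta>\<^sup>2)) * (1 / q))"
    by (rule real_sqrt_mult[symmetric])
  also have "?W / ((1 - (cmod w)\<^sup>2) * (1 - \<theta>\<^sup>2)) * (1 / q) = ?W * q / ((q - (cmod \<zeta>)\<^sup>2) * (q - 1))"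
  proof -
    have "(cmod w)\<^sup>2 = (cmod \<zeta>)\<^sup>2 / q" by (simp add: w_def norm_mult power_mult_distrib \<theta>2)
    then have 1: "1 - (cmod w)\<^sup>2 = (q - (cmod \<zeta>)\<^sup>2) / q" and 2: "1 - \<theta>\<^sup>2 = (q - 1) / q"
      using q by (simp_all add: \<theta>2 field_simps)
    show ?thesis unfolding 1 2 using q by simp
  qed
  finally show ?thesis .
qed


section \<open>Choice of the radius\<close>

lemma one_plus_inverse_power_le:
  assumes "N \<ge> (1::nat)"
  shows "(1 + 1 / real N) ^ N \<le> exp 1"
proof -
  have "(1 + 1 / real N) ^ N \<le> exp (1 / real N) ^ N"
    by (intro power_mono exp_ge_add_one_self) auto
  also have "\<dots> = exp 1" using assms by (simp flip: exp_of_nat_mult)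
  finally show ?thesis .
qed

text \<open>
  Each factor grows by at most \<open>1 + 1 / N\<close> when \<open>1\<close> is replaced by \<open>q = 1 + d / N\<close> inside, because
  \<open>d / N\<close> is at most the \<open>N\<close>-th part of \<open>\<bar>1 - cnj \<mu>\<^sub>i \<zeta>\<bar>\<close>; the squares of \<open>N\<close> such factors multiply to
  at most \<open>e\<^sup>2\<close>.
\<close>

lemma enlarged_product_le:
  fixes \<mu> :: "'i \<Rightarrow> complex"
  assumes S: "finite S" "card S = N" "N \<ge> 1" and d: "d > 0"
    and d_le: "\<And>i. i \<in> S \<Longrightarrow> d \<le> cmod (1 - cnj (\<mu> i) * \<zeta>)"
    and q: "q = 1 + d / real N"
  shows "(\<Prod>i\<in>S. (cmod (of_real q - cnj (\<mu> i) * \<zeta>))\<^sup>2 / (q * (cmod (\<zeta> - \<mu> i))\<^sup>2))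
    \<le> (exp 1)\<^sup>2 / q ^ N * (\<Prod>i\<in>S. (cmod (1 - cnj (\<mu> i) * \<zeta>) / cmod (\<zeta> - \<mu> i))\<^sup>2)"
proof -
  have q0: "q > 0" using q d by (simp add: add_pos_nonneg)
  have "(\<Prod>i\<in>S. (cmod (of_real q - cnj (\<mu> i) * \<zeta>))\<^sup>2 / (q * (cmod (\<zeta> - \<mu> i))\<^sup>2))
      \<le> (\<Prod>i\<in>S. ((1 + 1 / real N)\<^sup>2 / q) * (cmod (1 - cnj (\<mu> i) * \<zeta>) / cmod (\<zeta> - \<mu> i))\<^sup>2)"
  proof (rule prod_mono, intro conjI)
    fix i assume i: "i \<in> S"
    show "0 \<le> (cmod (of_real q - cnj (\<mu> i) * \<zeta>))\<^sup>2 / (q * (cmod (\<zeta> - \<mu> i))\<^sup>2)"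
      using q0 by simp
    have "cmod (of_real q - cnj (\<mu> i) * \<zeta>) = cmod ((1 - cnj (\<mu> i) * \<zeta>) + of_real (d / real N))"
      by (simp add: q algebra_simps)
    also have "\<dots> \<le> cmod (1 - cnj (\<mu> i) * \<zeta>) + cmod (of_real (d / real N))"
      by (rule norm_triangle_ineq)
    also have "cmod (of_real (d / real N)) = d / real N"
      using d by (simp only: norm_of_real) simp
    also have "d / real N \<le> cmod (1 - cnj (\<mu> i) * \<zeta>) / real N"
      by (intro divide_right_mono d_le i) auto
    finally have "cmod (of_real q - cnj (\<mu> i) * \<zeta>) \<le> (1 + 1 / real N) * cmod (1 - cnj (\<mu> i) * \<zeta>)"
      by (simp add: algebra_simps)
    then have "(cmod (of_real q - cnj (\<mu> i) * \<zeta>))\<^sup>2 \<le> ((1 + 1 / real N) * cmod (1 - cnj (\<mu> i) * \<zeta>))\<^sup>2"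
      by (intro power_mono) auto
    then have "(cmod (of_real q - cnj (\<mu> i) * \<zeta>))\<^sup>2 / (q * (cmod (\<zeta> - \<mu> i))\<^sup>2)
        \<le> ((1 + 1 / real N) * cmod (1 - cnj (\<mu> i) * \<zeta>))\<^sup>2 / (q * (cmod (\<zeta> - \<mu> i))\<^sup>2)"
      using q0 by (intro divide_right_mono) auto
    then show "(cmod (of_real q - cnj (\<mu> i) * \<zeta>))\<^sup>2 / (q * (cmod (\<zeta> - \<mu> i))\<^sup>2)
        \<le> ((1 + 1 / real N)\<^sup>2 / q) * (cmod (1 - cnj (\<mu> i) * \<zeta>) / cmod (\<zeta> - \<mu> i))\<^sup>2"
      by (simp add: power_mult_distrib power_divide)
  qed
  also have "\<dots> = ((1 + 1 / real N)\<^sup>2 / q) ^ N * (\<Prod>i\<in>S. (cmod (1 - cnj (\<mu> i) * \<zeta>) / cmod (\<zeta> - \<mu> i))\<^sup>2)"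
    by (simp only: prod.distrib prod_constant S)
  also have "((1 + 1 / real N)\<^sup>2 / q) ^ N = ((1 + 1 / real N) ^ N)\<^sup>2 / q ^ N"
    by (simp add: power_divide power_mult[symmetric] mult.commute)
  also have "\<dots> * (\<Prod>i\<in>S. (cmod (1 - cnj (\<mu> i) * \<zeta>) / cmod (\<zeta> - \<mu> i))\<^sup>2)
      \<le> (exp 1)\<^sup>2 / q ^ N * (\<Prod>i\<in>S. (cmod (1 - cnj (\<mu> i) * \<zeta>) / cmod (\<zeta> - \<mu> i))\<^sup>2)"
    using q0 S by (intro mult_right_mono divide_right_mono power_mono one_plus_inverse_power_le
        prod_nonneg) auto
  finally show ?thesis .
qed

lemma zero_lower_bound:
  fixes T :: "'a::complex_banach \<Rightarrow> 'a"
  assumes T: "bounded_clinear T" and pow: "\<And>k x. norm ((T ^^ k) x) \<le> C * norm x"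
    and C: "0 \<le> C" and S: "finite S" "card S = N" "N \<ge> 1"
    and \<mu>: "\<And>i. i \<in> S \<Longrightarrow> cmod (\<mu> i) \<le> 1"
    and ann: "\<And>x. poly_op (\<Prod>i\<in>S. [:- \<mu> i, 1:]) T x = 0"
    and r: "r > 0" "\<And>i. i \<in> S \<Longrightarrow> r \<le> cmod (\<mu> i)"
  shows "norm y \<le> C * (sqrt (real N * (exp 1 - r ^ (2 * N))) / r ^ N) * norm (0 *\<^sub>C y - T y)"
proof -
  define q where "q = 1 + 1 / real N"
  have q: "q > 1" "q - 1 = 1 / real N" using S by (simp_all add: q_def)
  let ?W = "\<Prod>i\<in>S. (cmod (of_real q - cnj (\<mu> i) * 0))\<^sup>2 / (q * (cmod (0 - \<mu> i))\<^sup>2)"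
  have "?W = (\<Prod>i\<in>S. q / (cmod (\<mu> i))\<^sup>2)"
    using q by (simp add: power2_eq_square)
  also have "\<dots> \<le> (\<Prod>i\<in>S. q / r\<^sup>2)"
    using q r order_less_le_trans[OF r(1) r(2)]
    by (intro prod_mono conjI divide_left_mono power_mono mult_pos_pos) auto
  also have "\<dots> = q ^ N / r ^ (2 * N)"
    by (simp add: S power_divide power_mult)
  also have "\<dots> \<le> exp 1 / r ^ (2 * N)"
    using r S unfolding q_def by (intro divide_right_mono one_plus_inverse_power_le) auto
  finally have W: "?W \<le> exp 1 / r ^ (2 * N)" .
  have "norm y \<le> C * sqrt ((?W - 1) * q / ((q - (cmod 0)\<^sup>2) * (q - 1))) * norm (0 *\<^sub>C y - T y)"
    using r by (intro power_bounded_lower_bound[OF T pow C q(1) _ S(1) \<mu> _ ann]) fastforce+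
  also have "sqrt ((?W - 1) * q / ((q - (cmod 0)\<^sup>2) * (q - 1)))
      \<le> sqrt (real N * (exp 1 - r ^ (2 * N)) / (r ^ N)\<^sup>2)"
  proof (rule real_sqrt_le_mono)
    have "(?W - 1) * q / ((q - (cmod 0)\<^sup>2) * (q - 1)) = (?W - 1) * real N"
      using q(1) unfolding q(2) by simp
    also have "\<dots> \<le> (exp 1 / r ^ (2 * N) - 1) * real N"
      using W by (intro mult_right_mono) auto
    also have "\<dots> = real N * (exp 1 - r ^ (2 * N)) / (r ^ N)\<^sup>2"
      using r(1) by (simp add: field_simps power_mult[symmetric])
    finally show "(?W - 1) * q / ((q - (cmod 0)\<^sup>2) * (q - 1)) \<le> \<dots>" .
  qed
  also have "\<dots> = sqrt (real N * (exp 1 - r ^ (2 * N))) / r ^ N"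
    using r(1) by (simp add: real_sqrt_divide)
  finally show ?thesis using C by (simp add: mult_left_mono mult_right_mono)
qed

text \<open>
  With \<open>x = \<bar>1 - cnj l \<zeta>\<bar>\<close> one has \<open>(1 - r\<^sup>2) x\<^sup>2 = (1 - \<bar>l\<bar>\<^sup>2) (1 - \<bar>\<zeta>\<bar>\<^sup>2)\<close>, which gives the second estimate
  because \<open>d \<le> x\<close>.
  The first one uses in addition \<open>\<bar>x - 1\<bar> \<le> \<bar>l\<bar> \<bar>\<zeta>\<bar>\<close>, that is
  \<open>x\<^sup>2 + \<bar>\<zeta>\<bar>\<^sup>2 (1 - \<bar>l\<bar>\<^sup>2) \<le> 2 x - (1 - \<bar>\<zeta>\<bar>\<^sup>2)\<close>. They trade the factor \<open>1 / (1 - \<bar>\<zeta>\<bar>\<^sup>2)\<close> of the Hardy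
  norm for the two summands of the bound inside the disk.
\<close>

lemma pseudohyperbolic_estimates:
  assumes s: "cmod \<zeta> < 1" and l: "cmod l \<le> 1"
    and r: "r = cmod ((\<zeta> - l) / (1 - cnj l * \<zeta>))" "0 < r" "r < 1"
    and d: "0 < d" "d \<le> cmod (1 - cnj l * \<zeta>)"
  shows "d / (1 - (cmod \<zeta>)\<^sup>2) \<le> 2 / (1 - r * cmod \<zeta>)"
    and "d\<^sup>2 / (1 - (cmod \<zeta>)\<^sup>2) \<le> 1 / (1 - r\<^sup>2)"
proof -
  define x where "x = cmod (1 - cnj l * \<zeta>)"
  define s' where "s' = cmod \<zeta>"
  have x: "x > 0" using d unfolding x_def by linarith
  have s': "0 \<le> s'" "s' < 1" using s by (simp_all add: s'_def)
  have s2: "1 - s'\<^sup>2 > 0" using s' by (simp add: abs_square_less_1)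
  have r2: "1 - r\<^sup>2 > 0" using r by (simp add: abs_square_less_1)
  have "1 - cnj l * \<zeta> \<noteq> 0" using x unfolding x_def zero_less_norm_iff .
  then have "1 - r\<^sup>2 = (1 - (cmod l)\<^sup>2) * (1 - s'\<^sup>2) / x\<^sup>2"
    unfolding r(1) x_def s'_def by (rule one_minus_blaschke_factor)
  then have id: "(1 - r\<^sup>2) * x\<^sup>2 = (1 - (cmod l)\<^sup>2) * (1 - s'\<^sup>2)"
    using x by simp
  have rs: "r * s' < 1"
    using r s' by (metis mult_left_le order_le_less_trans order_less_imp_le)
  have "\<bar>x - 1\<bar> \<le> cmod l * s'"
    using norm_triangle_ineq3[of "1 - cnj l * \<zeta>" 1] by (simp add: x_def s'_def norm_mult)
  then have "(x - 1)\<^sup>2 \<le> (cmod l * s')\<^sup>2"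
    by (metis abs_ge_zero power2_abs power_mono)
  then have quad: "x\<^sup>2 + s'\<^sup>2 * (1 - (cmod l)\<^sup>2) \<le> 2 * x"
    using s2 by (simp add: power2_eq_square algebra_simps)
  have "x\<^sup>2 * (1 - r\<^sup>2 * s'\<^sup>2) = x\<^sup>2 * (1 - s'\<^sup>2) + s'\<^sup>2 * ((1 - r\<^sup>2) * x\<^sup>2)"
    by (simp add: algebra_simps)
  also have "\<dots> = (1 - s'\<^sup>2) * (x\<^sup>2 + s'\<^sup>2 * (1 - (cmod l)\<^sup>2))"
    unfolding id by (simp add: algebra_simps)
  also have "\<dots> \<le> (1 - s'\<^sup>2) * (2 * x)"
    using quad s2 by (intro mult_left_mono) auto
  finally have "x * (x * (1 - r\<^sup>2 * s'\<^sup>2)) \<le> x * (2 * (1 - s'\<^sup>2))"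
    by (simp add: power2_eq_square mult_ac)
  then have main: "x * (1 - r\<^sup>2 * s'\<^sup>2) \<le> 2 * (1 - s'\<^sup>2)" using x by simp
  have "(r * s') * (r * s') \<le> r * s'" using rs r s' by (intro mult_left_le) auto
  then have "1 - r * s' \<le> 1 - r\<^sup>2 * s'\<^sup>2" by (simp add: power2_eq_square mult_ac)
  then have "d * (1 - r * s') \<le> x * (1 - r\<^sup>2 * s'\<^sup>2)"
    using d rs x unfolding x_def by (intro mult_mono) auto
  with main have "d * (1 - r * s') \<le> 2 * (1 - s'\<^sup>2)" by linarith
  then show "d / (1 - (cmod \<zeta>)\<^sup>2) \<le> 2 / (1 - r * cmod \<zeta>)"
    using s2 rs by (simp add: s'_def divide_simps mult_ac)
  have "d\<^sup>2 * (1 - r\<^sup>2) \<le> x\<^sup>2 * (1 - r\<^sup>2)"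
    using d r2 unfolding x_def by (intro mult_right_mono power_mono) auto
  also have "\<dots> \<le> 1 * (1 - s'\<^sup>2)"
    using s2 unfolding mult.commute[of "x\<^sup>2"] id by (intro mult_right_mono) auto
  finally show "d\<^sup>2 / (1 - (cmod \<zeta>)\<^sup>2) \<le> 1 / (1 - r\<^sup>2)"
    using s2 r2 by (simp add: s'_def divide_simps mult_ac)
qed

lemma disk_lower_bound:
  fixes T :: "'a::complex_banach \<Rightarrow> 'a"
  assumes T: "bounded_clinear T" and pow: "\<And>k x. norm ((T ^^ k) x) \<le> C * norm x"
    and C: "0 \<le> C" and S: "finite S" "card S = N" "N \<ge> 1"
    and \<mu>: "\<And>i. i \<in> S \<Longrightarrow> cmod (\<mu> i) \<le> 1"
    and ann: "\<And>x. poly_op (\<Prod>i\<in>S. [:- \<mu> i, 1:]) T x = 0"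
    and \<zeta>: "cmod \<zeta> < 1"
    and r: "0 < r" "r < 1" "\<And>i. i \<in> S \<Longrightarrow> r \<le> cmod ((\<zeta> - \<mu> i) / (1 - cnj (\<mu> i) * \<zeta>))"
    and j: "j \<in> S" "r = cmod ((\<zeta> - \<mu> j) / (1 - cnj (\<mu> j) * \<zeta>))"
    and d: "d > 0" "\<And>i. i \<in> S \<Longrightarrow> d \<le> cmod (1 - cnj (\<mu> i) * \<zeta>)"
  shows "norm y \<le> C * exp 1 * sqrt 2 * (sqrt (real N) / (d * r ^ N)) *
      sqrt (1 / (1 - r * cmod \<zeta>) + 1 / (2 * (1 - r\<^sup>2) * real N)) * norm (\<zeta> *\<^sub>C y - T y)"
proof -
  define q where "q = 1 + d / real N"
  have q: "q > 1" "q - 1 = d / real N" using S d by (simp_all add: q_def)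
  define s where "s = cmod \<zeta>"
  have s2: "1 - s\<^sup>2 > 0" using \<zeta> by (simp add: s_def abs_square_less_1)
  have r2: "1 - r\<^sup>2 > 0" using r by (simp add: abs_square_less_1)
  have rs: "1 - r * s > 0"
    using r \<zeta> unfolding s_def
    by (metis diff_gt_0_iff_gt mult_left_le norm_ge_zero order_le_less_trans order_less_imp_le)
  let ?W = "\<Prod>i\<in>S. (cmod (of_real q - cnj (\<mu> i) * \<zeta>))\<^sup>2 / (q * (cmod (\<zeta> - \<mu> i))\<^sup>2)"
  let ?Z = "1 / (1 - r * s) + 1 / (2 * (1 - r\<^sup>2) * real N)"
  let ?R = "exp 1 * sqrt 2 * (sqrt (real N) / (d * r ^ N)) * sqrt ?Z"
  have "(\<Prod>i\<in>S. (cmod (1 - cnj (\<mu> i) * \<zeta>) / cmod (\<zeta> - \<mu> i))\<^sup>2) \<le> (\<Prod>i\<in>S. (1 / r)\<^sup>2)"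
  proof (intro prod_mono conjI power_mono)
    fix i assume i: "i \<in> S"
    have "cmod (\<zeta> - \<mu> i) / cmod (1 - cnj (\<mu> i) * \<zeta>) \<ge> r"
      using r(3)[OF i] by (simp add: norm_divide)
    from le_imp_inverse_le[OF this r(1)]
    show "cmod (1 - cnj (\<mu> i) * \<zeta>) / cmod (\<zeta> - \<mu> i) \<le> 1 / r"
      by (simp add: inverse_eq_divide)
  qed auto
  also have "\<dots> = 1 / r ^ (2 * N)"
    by (simp add: S power_divide power_mult)
  finally have P: "(\<Prod>i\<in>S. (cmod (1 - cnj (\<mu> i) * \<zeta>) / cmod (\<zeta> - \<mu> i))\<^sup>2) \<le> 1 / r ^ (2 * N)" .
  have "?W \<le> (exp 1)\<^sup>2 / q ^ N * (\<Prod>i\<in>S. (cmod (1 - cnj (\<mu> i) * \<zeta>) / cmod (\<zeta> - \<mu> i))\<^sup>2)"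
    by (rule enlarged_product_le[OF S d q_def])
  also have "\<dots> \<le> (exp 1)\<^sup>2 / 1 * (1 / r ^ (2 * N))"
    using q(1) P by (intro mult_mono divide_left_mono prod_nonneg) auto
  finally have W: "?W - 1 \<le> (exp 1)\<^sup>2 / r ^ (2 * N)" by simp
  have "norm y \<le> C * sqrt ((?W - 1) * q / ((q - (cmod \<zeta>)\<^sup>2) * (q - 1))) * norm (\<zeta> *\<^sub>C y - T y)"
    using r \<zeta> by (intro power_bounded_lower_bound[OF T pow C q(1) _ S(1) \<mu> _ ann]) fastforce+
  also have "sqrt ((?W - 1) * q / ((q - (cmod \<zeta>)\<^sup>2) * (q - 1))) \<le> ?R"
  proof (rule real_le_lsqrt)
    have "(?W - 1) * q / ((q - (cmod \<zeta>)\<^sup>2) * (q - 1))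
        \<le> ((exp 1)\<^sup>2 / r ^ (2 * N)) * q / ((1 - s\<^sup>2) * (q - 1))"
      using W q(1) s2 r(1) unfolding s_def
      by (intro frac_le mult_right_mono mult_nonneg_nonneg mult_pos_pos) auto
    also have "\<dots> = ((exp 1)\<^sup>2 / (r ^ (2 * N) * d\<^sup>2)) * (real N * (d / (1 - s\<^sup>2)) + d\<^sup>2 / (1 - s\<^sup>2))"
      unfolding q(2) using d(1) s2 r(1) S(3)
      by (simp add: q_def divide_simps) (simp add: power2_eq_square algebra_simps)
    also have "\<dots> \<le> ((exp 1)\<^sup>2 / (r ^ (2 * N) * d\<^sup>2)) * (real N * (2 / (1 - r * s)) + 1 / (1 - r\<^sup>2))"
      using pseudohyperbolic_estimates[OF \<zeta> \<mu>[OF j(1)] j(2) r(1,2) d(1) d(2)[OF j(1)]] r(1)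
      unfolding s_def by (intro mult_left_mono add_mono) auto
    also have "real N * (2 / a) + 1 / b = 2 * real N * (1 / a + 1 / (2 * b * real N))" for a b
      using S(3) by (simp add: distrib_left)
    also have "((exp 1)\<^sup>2 / (r ^ (2 * N) * d\<^sup>2)) * (2 * real N * ?Z) = ?R\<^sup>2"
      using rs r2 by (simp add: power_mult_distrib power_divide power_mult[symmetric] mult_ac)
    finally show "(?W - 1) * q / ((q - (cmod \<zeta>)\<^sup>2) * (q - 1)) \<le> ?R\<^sup>2" .
  qed (use rs r2 r d in auto)
  finally show ?thesis using C by (simp add: s_def mult_left_mono mult_right_mono mult.assoc)
qed

text \<open>
  On the unit circle \<open>\<bar>1 - cnj \<mu>\<^sub>i \<zeta>\<bar> = \<bar>\<zeta> - \<mu>\<^sub>i\<bar>\<close>, so the Blaschke product of the unit disk has modulus one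
  at \<open>\<zeta>\<close> and only the enlargement factor remains. The summand \<open>-1\<close> of the Hardy norm is kept here
  and produces \<open>e\<^sup>2 - 1\<close>.
\<close>

lemma circle_lower_bound:
  fixes T :: "'a::complex_banach \<Rightarrow> 'a"
  assumes T: "bounded_clinear T" and pow: "\<And>k x. norm ((T ^^ k) x) \<le> C * norm x"
    and C: "0 \<le> C" and S: "finite S" "card S = N" "N \<ge> 1"
    and \<mu>: "\<And>i. i \<in> S \<Longrightarrow> cmod (\<mu> i) \<le> 1"
    and ann: "\<And>x. poly_op (\<Prod>i\<in>S. [:- \<mu> i, 1:]) T x = 0"
    and \<zeta>: "cmod \<zeta> = 1" and d: "d > 0" "\<And>i. i \<in> S \<Longrightarrow> d \<le> cmod (\<zeta> - \<mu> i)"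
  shows "norm y \<le> C * (sqrt ((exp 1)\<^sup>2 - 1) * (real N / d)) * norm (\<zeta> *\<^sub>C y - T y)"
proof -
  define q where "q = 1 + d / real N"
  have q: "q > 1" "q - 1 = d / real N" using S d by (simp_all add: q_def)
  have "\<zeta> * cnj \<zeta> = 1" using \<zeta> by (simp add: complex_norm_square[symmetric])
  then have "1 - cnj z * \<zeta> = cnj (\<zeta> - z) * \<zeta>" for z by (simp add: algebra_simps)
  then have circ: "cmod (1 - cnj z * \<zeta>) = cmod (\<zeta> - z)" for z
    using \<zeta> by (metis complex_mod_cnj mult.right_neutral norm_mult)
  let ?W = "\<Prod>i\<in>S. (cmod (of_real q - cnj (\<mu> i) * \<zeta>))\<^sup>2 / (q * (cmod (\<zeta> - \<mu> i))\<^sup>2)"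
  have "?W \<le> (exp 1)\<^sup>2 / q ^ N * (\<Prod>i\<in>S. (cmod (1 - cnj (\<mu> i) * \<zeta>) / cmod (\<zeta> - \<mu> i))\<^sup>2)"
    by (rule enlarged_product_le[OF S d(1) _ q_def]) (simp add: circ d(2))
  also have "(\<Prod>i\<in>S. (cmod (1 - cnj (\<mu> i) * \<zeta>) / cmod (\<zeta> - \<mu> i))\<^sup>2) = 1"
    using d by (intro prod.neutral) (fastforce simp: circ)
  finally have W: "?W \<le> (exp 1)\<^sup>2 / q ^ N" by simp
  have e: "(exp 1)\<^sup>2 - 1 \<ge> (0::real)" by simp
  have "norm y \<le> C * sqrt ((?W - 1) * q / ((q - (cmod \<zeta>)\<^sup>2) * (q - 1))) * norm (\<zeta> *\<^sub>C y - T y)"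
    using d \<zeta> by (intro power_bounded_lower_bound[OF T pow C q(1) _ S(1) \<mu> _ ann]) fastforce+
  also have "sqrt ((?W - 1) * q / ((q - (cmod \<zeta>)\<^sup>2) * (q - 1))) \<le> sqrt ((exp 1)\<^sup>2 - 1) * (real N / d)"
  proof (rule real_le_lsqrt)
    \<comment> \<open>The factor \<open>q\<close> from the Cauchy-Schwarz step is absorbed by the denominator of \<open>?W\<close>.\<close>
    have qN: "q \<le> q ^ N" using q(1) S(3) by (metis less_imp_le power_increasing power_one_right)
    have "(?W - 1) * q \<le> ((exp 1)\<^sup>2 / q ^ N - 1) * q"
      using W q(1) by (intro mult_right_mono) auto
    also have "\<dots> = (exp 1)\<^sup>2 * (q / q ^ N) - q" by (simp add: algebra_simps)
    also have "\<dots> \<le> (exp 1)\<^sup>2 * 1 - 1"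
      using q(1) qN by (intro diff_mono mult_left_mono) (auto simp: divide_le_eq)
    finally have "(?W - 1) * q / ((q - 1) * (q - 1)) \<le> ((exp 1)\<^sup>2 - 1) / ((q - 1) * (q - 1))"
      by (intro divide_right_mono) auto
    also have "\<dots> = (sqrt ((exp 1)\<^sup>2 - 1) * (real N / d))\<^sup>2"
      using e d(1) S(3) unfolding q(2) by (simp add: power_mult_distrib power2_eq_square)
    finally show "(?W - 1) * q / ((q - (cmod \<zeta>)\<^sup>2) * (q - 1)) \<le> \<dots>"
      by (simp add: \<zeta>)
  qed (use e d in auto)
  finally show ?thesis using C by (simp add: mult_left_mono mult_right_mono)
qed


section \<open>Spectrum on the unit circle\<close>

lemma cesaro_mean_power:
  fixes z :: complex
  assumes "cmod z = 1"
  shows "(\<lambda>K. (\<Sum>k<K. z ^ k) / of_nat K) \<longlonglongrightarrow> (if z = 1 then 1 else 0)"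
proof (cases "z = 1")
  case True
  have "\<forall>\<^sub>F K in sequentially. (\<Sum>k<K. z ^ k) / of_nat K = 1"
    using eventually_gt_at_top[of 0] by eventually_elim (simp add: True)
  then show ?thesis using True by (simp add: tendsto_eventually)
next
  case False
  have "(\<lambda>K. (\<Sum>k<K. z ^ k) / of_nat K) \<longlonglongrightarrow> 0"
  proof (rule Lim_null_comparison)
    show "(\<lambda>K. 2 / cmod (z - 1) / real K) \<longlonglongrightarrow> 0"
      by (rule lim_const_over_n)
    have bound: "cmod (\<Sum>k<K. z ^ k) \<le> 2 / cmod (z - 1)" for K
    proof -
      have "cmod (z ^ K - 1) \<le> cmod (z ^ K) + cmod 1" by (rule norm_triangle_ineq4)
      then show ?thesis
        using False assms by (simp add: geometric_sum norm_divide norm_power divide_right_mono)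
    qed
    show "\<forall>\<^sub>F K in sequentially. norm ((\<Sum>k<K. z ^ k) / of_nat K) \<le> 2 / cmod (z - 1) / real K"
      by (intro always_eventually allI)
        (simp only: norm_divide norm_of_nat divide_right_mono[OF bound] of_nat_0_le_iff)
  qed
  then show ?thesis using False by simp
qed

lemma cnj_mult_eq_one_iff:
  assumes "cmod a = 1"
  shows "cnj a * b = 1 \<longleftrightarrow> b = a"
proof -
  have a: "a * cnj a = 1" using assms by (simp add: complex_norm_square[symmetric])
  show ?thesis
  proof
    assume b: "cnj a * b = 1"
    have "b = (a * cnj a) * b" by (simp only: a mult_1)
    also have "\<dots> = a" using b by (simp only: mult.assoc mult_1_right)
    finally show "b = a" .
  next
    assume "b = a"
    then show "cnj a * b = 1" using a by (simp only: mult.commute)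
  qed
qed

lemma tendsto_scaleC_left:
  fixes x :: "'a::complex_banach"
  assumes "(a \<longlongrightarrow> l) F"
  shows "((\<lambda>n. a n *\<^sub>C x) \<longlongrightarrow> l *\<^sub>C x) F"
proof -
  have "bounded_linear (\<lambda>a. a *\<^sub>C x)"
  proof (rule bounded_linear_intro)
    fix a b :: complex and r :: real
    show "(a + b) *\<^sub>C x = a *\<^sub>C x + b *\<^sub>C x" by (rule scaleC_add_left)
    show "(r *\<^sub>R a) *\<^sub>C x = r *\<^sub>R (a *\<^sub>C x)"
      by (simp add: scaleR_conv_of_real scaleC_scaleC[symmetric] scaleC_of_real)
    show "norm (a *\<^sub>C x) \<le> norm a * norm x" by (simp add: norm_scaleC)
  qed
  then show ?thesis using assms by (rule bounded_linear.tendsto)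
qed

lemma scaleC_sum_left: "(\<Sum>i\<in>A. f i) *\<^sub>C x = (\<Sum>i\<in>A. f i *\<^sub>C (x :: 'a::complex_banach))"
  by (induction A rule: infinite_finite_induct) (auto simp: scaleC_add_left)

text \<open>
  The averages of \<open>p\<^sub>k T\<^sup>k u\<close>, with \<open>p\<^sub>k = \<Sum>\<^sub>j f\<^sub>j (cnj \<mu>\<^sub>j)\<^sup>k\<close>, tend to the image of \<open>u\<close> under the
  multiplier \<open>f\<close>, because distinct characters \<open>\<mu>\<^sub>j\<^sup>k\<close> are orthogonal in the mean. By the same
  orthogonality the mean square of \<open>p\<close> tends to the sum of the \<open>\<bar>f\<^sub>j\<bar>\<^sup>2\<close>.
\<close>

lemma unimodular_multiplier_bound:
  fixes T :: "'a::complex_banach \<Rightarrow> 'a"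
  assumes T: "bounded_clinear T" and pow: "\<And>k x. norm ((T ^^ k) x) \<le> C * norm x"
    and C: "0 \<le> C" and S: "finite S" and inj: "inj_on \<mu> S"
    and \<mu>: "\<And>i. i \<in> S \<Longrightarrow> cmod (\<mu> i) = 1"
    and eig: "\<And>i. i \<in> S \<Longrightarrow> T (x i) = \<mu> i *\<^sub>C x i"
  shows "norm (\<Sum>i\<in>S. f i *\<^sub>C x i) \<le> C * sqrt (\<Sum>i\<in>S. (cmod (f i))\<^sup>2) * norm (\<Sum>i\<in>S. x i)"
proof -
  define u where "u = (\<Sum>i\<in>S. x i)"
  define p where "p = (\<lambda>k. \<Sum>j\<in>S. f j * cnj (\<mu> j) ^ k)"
  define M where "M = (\<lambda>z K. (\<Sum>k<K. z ^ k) / complex_of_nat K)"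
  have M_lim: "M (cnj (\<mu> j) * \<mu> i) \<longlonglongrightarrow> (if j = i then 1 else 0)" if "i \<in> S" "j \<in> S" for i j
  proof -
    have "(cnj (\<mu> j) * \<mu> i = 1) \<longleftrightarrow> j = i"
      using cnj_mult_eq_one_iff[OF \<mu>[OF that(2)]] inj that by (auto simp: inj_on_def)
    then show ?thesis
      using cesaro_mean_power[of "cnj (\<mu> j) * \<mu> i"] \<mu> that by (simp add: M_def norm_mult)
  qed
  have p_conv: "(\<Sum>k<K. p k * \<mu> i ^ k) / of_nat K = (\<Sum>j\<in>S. f j * M (cnj (\<mu> j) * \<mu> i) K)" for K i
  proof -
    have "(\<Sum>k<K. p k * \<mu> i ^ k) = (\<Sum>k<K. \<Sum>j\<in>S. f j * (cnj (\<mu> j) * \<mu> i) ^ k)"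
      by (simp add: p_def sum_distrib_left sum_distrib_right power_mult_distrib mult_ac)
    also have "\<dots> = (\<Sum>j\<in>S. f j * (\<Sum>k<K. (cnj (\<mu> j) * \<mu> i) ^ k))"
      by (subst sum.swap) (simp add: sum_distrib_left)
    finally show ?thesis
      by (simp only: M_def times_divide_eq_right sum_divide_distrib[symmetric])
  qed
  have p_lim: "(\<lambda>K. (\<Sum>k<K. p k * \<mu> i ^ k) / of_nat K) \<longlonglongrightarrow> f i" if "i \<in> S" for i
  proof -
    have "(\<lambda>K. \<Sum>j\<in>S. f j * M (cnj (\<mu> j) * \<mu> i) K) \<longlonglongrightarrow> (\<Sum>j\<in>S. f j * (if j = i then 1 else 0))"
      using that by (intro tendsto_sum tendsto_mult tendsto_const M_lim)
    also have "(\<Sum>j\<in>S. f j * (if j = i then 1 else 0)) = f i"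
      using S that by (simp add: if_distrib cong: if_cong)
    finally show ?thesis by (simp only: p_conv)
  qed
  define v where "v = (\<lambda>K. (1 / complex_of_nat K) *\<^sub>C (\<Sum>k<K. p k *\<^sub>C (T ^^ k) u))"
  have "v K = (\<Sum>i\<in>S. ((\<Sum>k<K. p k * \<mu> i ^ k) / of_nat K) *\<^sub>C x i)" for K
  proof -
    have "(T ^^ k) u = (\<Sum>i\<in>S. \<mu> i ^ k *\<^sub>C x i)" for k
      unfolding u_def bounded_clinearD(6)[OF bounded_clinear_funpow[OF T]]
      by (intro sum.cong refl funpow_eigenvector[OF T eig])
    then have "(\<Sum>k<K. p k *\<^sub>C (T ^^ k) u) = (\<Sum>k<K. \<Sum>i\<in>S. (p k * \<mu> i ^ k) *\<^sub>C x i)"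
      by (simp add: scaleC_sum_right scaleC_scaleC)
    also have "\<dots> = (\<Sum>i\<in>S. (\<Sum>k<K. p k * \<mu> i ^ k) *\<^sub>C x i)"
      by (subst sum.swap) (simp add: scaleC_sum_left)
    finally have "v K = (1 / of_nat K) *\<^sub>C (\<Sum>i\<in>S. (\<Sum>k<K. p k * \<mu> i ^ k) *\<^sub>C x i)"
      by (simp only: v_def)
    then show ?thesis by (simp add: scaleC_sum_right scaleC_scaleC)
  qed
  then have "v = (\<lambda>K. \<Sum>i\<in>S. ((\<Sum>k<K. p k * \<mu> i ^ k) / of_nat K) *\<^sub>C x i)"
    by (rule ext)
  then have v_lim: "v \<longlonglongrightarrow> (\<Sum>i\<in>S. f i *\<^sub>C x i)"
    by (simp only:) (intro tendsto_sum tendsto_scaleC_left p_lim)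
  have energy: "complex_of_real ((\<Sum>k<K. (cmod (p k))\<^sup>2) / real K)
      = (\<Sum>i\<in>S. cnj (f i) * ((\<Sum>k<K. p k * \<mu> i ^ k) / of_nat K))" for K
  proof -
    have "complex_of_real (\<Sum>k<K. (cmod (p k))\<^sup>2) = (\<Sum>k<K. p k * cnj (p k))"
      by (simp only: of_real_sum complex_norm_square)
    also have "\<dots> = (\<Sum>k<K. \<Sum>i\<in>S. cnj (f i) * (p k * \<mu> i ^ k))"
      by (rule sum.cong[OF refl], subst (2) p_def) (simp add: sum_distrib_left mult_ac)
    also have "\<dots> = (\<Sum>i\<in>S. cnj (f i) * (\<Sum>k<K. p k * \<mu> i ^ k))"
      by (subst sum.swap) (simp add: sum_distrib_left)
    finally show ?thesis
      by (simp only: of_real_divide of_real_of_nat_eq times_divide_eq_right sum_divide_distrib[symmetric])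
  qed
  have "(\<lambda>K. complex_of_real ((\<Sum>k<K. (cmod (p k))\<^sup>2) / real K)) \<longlonglongrightarrow> (\<Sum>i\<in>S. cnj (f i) * f i)"
    unfolding energy by (intro tendsto_sum tendsto_mult tendsto_const p_lim)
  also have "(\<Sum>i\<in>S. cnj (f i) * f i) = complex_of_real (\<Sum>i\<in>S. (cmod (f i))\<^sup>2)"
    by (simp only: of_real_sum complex_norm_square mult.commute)
  finally have e_lim: "(\<lambda>K. (\<Sum>k<K. (cmod (p k))\<^sup>2) / real K) \<longlonglongrightarrow> (\<Sum>i\<in>S. (cmod (f i))\<^sup>2)"
    by (simp only: tendsto_of_real_iff)
  have v_le: "norm (v K) \<le> C * sqrt ((\<Sum>k<K. (cmod (p k))\<^sup>2) / real K) * norm u" for K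
  proof (cases "K = 0")
    case False
    have "norm (\<Sum>k<K. p k *\<^sub>C (T ^^ k) u) \<le> (\<Sum>k<K. cmod (p k) * (C * norm u))"
      by (rule sum_norm_le) (simp add: norm_scaleC mult_left_mono pow)
    then have "norm (v K) \<le> (C * norm u) * ((\<Sum>k<K. cmod (p k)) / real K)"
      using False by (simp add: v_def norm_scaleC norm_divide divide_simps sum_distrib_left mult_ac)
    also have "(\<Sum>k<K. cmod (p k)) / real K \<le> sqrt ((\<Sum>k<K. (cmod (p k))\<^sup>2) / real K)"
    proof (rule real_le_rsqrt)
      have "(\<Sum>k<K. cmod (p k) * 1)\<^sup>2 \<le> (\<Sum>k<K. (cmod (p k))\<^sup>2) * (\<Sum>k<K. 1\<^sup>2)"
        by (rule Cauchy_Schwarz_ineq_sum)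
      then have "(\<Sum>k<K. cmod (p k))\<^sup>2 / (real K)\<^sup>2 \<le> ((\<Sum>k<K. (cmod (p k))\<^sup>2) * real K) / (real K)\<^sup>2"
        by (intro divide_right_mono) auto
      then show "((\<Sum>k<K. cmod (p k)) / real K)\<^sup>2 \<le> (\<Sum>k<K. (cmod (p k))\<^sup>2) / real K"
        using False by (simp add: power_divide power2_eq_square)
    qed
    finally have "norm (v K) \<le> (C * norm u) * sqrt ((\<Sum>k<K. (cmod (p k))\<^sup>2) / real K)"
      using C by (simp add: mult_left_mono)
    then show ?thesis by (simp add: mult_ac)
  qed (simp add: v_def)
  show ?thesis
    unfolding u_def[symmetric]
    by (rule LIMSEQ_le[OF tendsto_norm[OF v_lim]
          tendsto_mult[OF tendsto_mult[OF tendsto_const tendsto_real_sqrt[OF e_lim]] tendsto_const]])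
      (use v_le in auto)
qed

text \<open>
  By induction \<open>(T - \<mu>\<^sub>a) y\<close> is a sum of eigenvectors \<open>x\<^sub>i\<close> for the other zeros. Dividing these by
  \<open>\<mu>\<^sub>i - \<mu>\<^sub>a\<close> and subtracting them from \<open>y\<close> leaves an eigenvector for \<open>\<mu>\<^sub>a\<close>.
\<close>

lemma eigenvector_decomposition:
  fixes T :: "'a::complex_banach \<Rightarrow> 'a"
  assumes T: "bounded_clinear T" and "finite S" and "inj_on \<mu> S"
    and "poly_op (\<Prod>i\<in>S. [:- \<mu> i, 1:]) T y = 0"
  shows "\<exists>x. (\<forall>i\<in>S. T (x i) = \<mu> i *\<^sub>C x i) \<and> y = (\<Sum>i\<in>S. x i)"
  using assms(2-)
proof (induction S arbitrary: y)
  case empty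
  then show ?case using poly_op_linear_factor[OF T, of 1 0 y] by (simp add: one_pCons)
next
  case (insert a S)
  let ?P = "\<Prod>i\<in>S. [:- \<mu> i, 1:]"
  have Plin: "bounded_clinear (poly_op ?P T)" by (rule bounded_clinear_poly_op[OF T])
  define z where "z = T y - \<mu> a *\<^sub>C y"
  have "poly_op [:- \<mu> a, 1:] T (poly_op ?P T y) = 0"
    using insert.prems(2) by (simp only: prod.insert[OF insert.hyps] poly_op_mult[OF T])
  then have "poly_op ?P T z = 0"
    by (simp only: poly_op_linear_factor[OF T] z_def bounded_clinearD[OF Plin] poly_op_commute[OF T]
        scaleC_minus_left) simp
  moreover have "inj_on \<mu> S" using insert.prems(1) by (simp add: inj_on_def)
  ultimately obtain x where x: "\<And>i. i \<in> S \<Longrightarrow> T (x i) = \<mu> i *\<^sub>C x i" "z = (\<Sum>i\<in>S. x i)"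
    using insert.IH by blast
  define x' where "x' = (\<lambda>i. (1 / (\<mu> i - \<mu> a)) *\<^sub>C x i)"
  have ne: "\<mu> i - \<mu> a \<noteq> 0" if "i \<in> S" for i
    using that insert by (auto simp: inj_on_def)
  have eig: "T (x' i) = \<mu> i *\<^sub>C x' i" if "i \<in> S" for i
    using x(1)[OF that] by (simp add: x'_def bounded_clinearD[OF T] scaleC_scaleC mult.commute)
  let ?y = "\<Sum>i\<in>S. x' i"
  have "T ?y - \<mu> a *\<^sub>C ?y = (\<Sum>i\<in>S. (\<mu> i - \<mu> a) *\<^sub>C x' i)"
    by (simp add: bounded_clinearD[OF T] scaleC_sum_right sum_subtractf[symmetric] eig scaleC_diff_left)
  also have "\<dots> = z"
    unfolding x(2) by (intro sum.cong refl) (auto simp: x'_def scaleC_scaleC dest: ne)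
  finally have "T (y - ?y) = \<mu> a *\<^sub>C (y - ?y)"
    by (simp add: z_def bounded_clinearD[OF T] scaleC_diff_right algebra_simps)
  moreover have "(\<Sum>i\<in>S. if i = a then y - ?y else x' i) = ?y"
    using insert.hyps by (intro sum.cong) auto
  ultimately show ?case
    using insert.hyps eig by (intro exI[of _ "\<lambda>i. if i = a then y - ?y else x' i"]) auto
qed

text \<open>
  The inverse of \<open>\<zeta> - T\<close> is the multiplier with values \<open>1 / (\<zeta> - \<mu>\<^sub>i)\<close>, each of modulus at most \<open>1 / d\<close>.
\<close>

lemma unimodular_spectrum_lower_bound:
  fixes T :: "'a::complex_banach \<Rightarrow> 'a"
  assumes T: "bounded_clinear T" and pow: "\<And>k x. norm ((T ^^ k) x) \<le> C * norm x"
    and C: "0 \<le> C" and S: "finite S" "card S = N" and inj: "inj_on \<mu> S"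
    and \<mu>: "\<And>i. i \<in> S \<Longrightarrow> cmod (\<mu> i) = 1"
    and ann: "\<And>x. poly_op (\<Prod>i\<in>S. [:- \<mu> i, 1:]) T x = 0"
    and d: "d > 0" "\<And>i. i \<in> S \<Longrightarrow> d \<le> cmod (\<zeta> - \<mu> i)"
  shows "norm y \<le> C * (sqrt (real N) / d) * norm (\<zeta> *\<^sub>C y - T y)"
proof -
  obtain x where eig: "\<And>i. i \<in> S \<Longrightarrow> T (x i) = \<mu> i *\<^sub>C x i" and y: "y = (\<Sum>i\<in>S. x i)"
    using eigenvector_decomposition[OF T S(1) inj ann] by blast
  define z where "z = (\<lambda>i. (\<zeta> - \<mu> i) *\<^sub>C x i)"
  have eig': "T (z i) = \<mu> i *\<^sub>C z i" if "i \<in> S" for i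
    using eig[OF that] by (simp add: z_def bounded_clinearD[OF T] scaleC_scaleC mult.commute)
  have ne: "\<zeta> - \<mu> i \<noteq> 0" if "i \<in> S" for i
    using d(1) d(2)[OF that] by auto
  have "(\<Sum>i\<in>S. (1 / (\<zeta> - \<mu> i)) *\<^sub>C z i) = y"
    unfolding y z_def by (intro sum.cong refl) (auto simp: scaleC_scaleC dest: ne)
  moreover have "(\<Sum>i\<in>S. z i) = \<zeta> *\<^sub>C y - T y"
    by (simp add: y z_def bounded_clinearD[OF T] scaleC_sum_right sum_subtractf[symmetric] eig
        scaleC_diff_left)
  moreover have "norm (\<Sum>i\<in>S. (1 / (\<zeta> - \<mu> i)) *\<^sub>C z i)
      \<le> C * sqrt (\<Sum>i\<in>S. (cmod (1 / (\<zeta> - \<mu> i)))\<^sup>2) * norm (\<Sum>i\<in>S. z i)"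
    by (rule unimodular_multiplier_bound[OF T pow C S(1) inj \<mu> eig'])
  moreover have "sqrt (\<Sum>i\<in>S. (cmod (1 / (\<zeta> - \<mu> i)))\<^sup>2) \<le> sqrt (real N) / d"
  proof -
    have "(\<Sum>i\<in>S. (cmod (1 / (\<zeta> - \<mu> i)))\<^sup>2) \<le> (\<Sum>i\<in>S. (1 / d)\<^sup>2)"
    proof (intro sum_mono power_mono)
      fix i assume "i \<in> S"
      from le_imp_inverse_le[OF d(2)[OF this] d(1)]
      show "cmod (1 / (\<zeta> - \<mu> i)) \<le> 1 / d" by (simp add: norm_divide inverse_eq_divide)
    qed auto
    also have "\<dots> = real N / d\<^sup>2" by (simp add: S(2) power_divide)
    finally have "sqrt (\<Sum>i\<in>S. (cmod (1 / (\<zeta> - \<mu> i)))\<^sup>2) \<le> sqrt (real N / d\<^sup>2)"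
      by (rule real_sqrt_le_mono)
    then show ?thesis using d(1) by (simp add: real_sqrt_divide)
  qed
  ultimately show ?thesis
    using C by (smt (verit) mult_left_mono mult_right_mono norm_ge_zero)
qed


section \<open>Zeros of the minimal polynomial\<close>

text \<open>
  Every zero is an eigenvalue, since dividing the minimal polynomial by its linear factor gives a
  polynomial that does not annihilate \<open>T\<close>.
\<close>

lemma minimal_poly_zero_le_1:
  fixes T :: "'a::complex_banach \<Rightarrow> 'a"
  assumes T: "bounded_clinear T" and pow: "\<And>k x. norm ((T ^^ k) x) \<le> C * norm x"
    and m: "is_minimal_poly T m" and z: "poly m z = 0"
  shows "cmod z \<le> 1"
proof (rule ccontr)
  assume gt: "\<not> cmod z \<le> 1"
  obtain q where q: "m = [:- z, 1:] * q"
    using z by (auto simp: poly_eq_0_iff_dvd)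
  have "m \<noteq> 0" using m by (auto simp: is_minimal_poly_def)
  then have "q \<noteq> 0" "degree m = Suc (degree q)"
    using q by (auto simp: degree_mult_eq simp del: mult_pCons_left)
  then have "poly_op q T \<noteq> (\<lambda>_. 0)"
    using m by (auto simp: is_minimal_poly_def)
  then obtain x where x: "poly_op q T x \<noteq> 0" by (auto simp: fun_eq_iff)
  let ?v = "poly_op q T x"
  have "poly_op [:- z, 1:] T ?v = 0"
    using m by (simp only: poly_op_mult[OF T, symmetric] q[symmetric] is_minimal_poly_def)
  then have "T ?v = z *\<^sub>C ?v"
    by (simp add: poly_op_linear_factor[OF T] scaleC_minus_left)
  then have "(T ^^ k) ?v = z ^ k *\<^sub>C ?v" for k by (rule funpow_eigenvector[OF T])
  then have "cmod z ^ k \<le> C" for k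
    using pow[of k ?v] x by (simp add: norm_scaleC norm_power)
  moreover obtain k where "C < cmod z ^ k"
    using real_arch_pow[of "cmod z" C] gt by auto
  ultimately show False by (meson not_le)
qed

text \<open>
  The usual formula \<open>A\<^sup>k u = z\<^sup>k u + k z\<^sup>k\<^sup>-\<^sup>1 v\<close>, multiplied by \<open>z\<close> to avoid the exponent \<open>k - 1\<close>.
\<close>

lemma funpow_generalized_eigenvector:
  fixes A :: "'a::complex_banach \<Rightarrow> 'a"
  assumes A: "bounded_clinear A" and v: "A v = z *\<^sub>C v" and u: "A u = z *\<^sub>C u + v"
  shows "z *\<^sub>C (A ^^ k) u = z ^ k *\<^sub>C (z *\<^sub>C u + of_nat k *\<^sub>C v)"
proof (induction k)
  case (Suc k)
  have "z *\<^sub>C (A ^^ Suc k) u = A (z *\<^sub>C (A ^^ k) u)"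
    by (simp add: bounded_clinearD[OF A])
  also have "\<dots> = z ^ Suc k *\<^sub>C (z *\<^sub>C u + of_nat (Suc k) *\<^sub>C v)"
    unfolding Suc
    by (simp add: bounded_clinearD[OF A] u v scaleC_scaleC scaleC_add_right scaleC_add_left algebra_simps)
  finally show ?case .
qed simp

text \<open>
  A double zero yields \<open>u\<close> and \<open>v \<noteq> 0\<close> with \<open>T u = z u + v\<close> and \<open>T v = z v\<close>, and then the powers of \<open>T\<close> at \<open>u\<close>
  grow linearly.
\<close>

lemma unimodular_zero_simple:
  fixes T :: "'a::complex_banach \<Rightarrow> 'a"
  assumes T: "bounded_clinear T" and pow: "\<And>k x. norm ((T ^^ k) x) \<le> C * norm x"
    and m: "is_minimal_poly T m" and z: "cmod z = 1"
  shows "\<not> [:- z, 1:] * [:- z, 1:] dvd m"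
proof
  assume "[:- z, 1:] * [:- z, 1:] dvd m"
  then obtain q where q: "m = [:- z, 1:] * ([:- z, 1:] * q)"
    unfolding dvd_def mult.assoc by blast
  let ?q = "[:- z, 1:] * q"
  have "m \<noteq> 0" using m by (auto simp: is_minimal_poly_def)
  then have "?q \<noteq> 0" using q by (metis mult_zero_right)
  then have "degree m = Suc (degree ?q)"
    unfolding q by (subst degree_mult_eq) auto
  then have "poly_op ?q T \<noteq> (\<lambda>_. 0)"
    using m \<open>?q \<noteq> 0\<close> by (metis Suc_n_not_le_n is_minimal_poly_def)
  then obtain x where x: "poly_op ?q T x \<noteq> 0" by (auto simp: fun_eq_iff)
  define u where "u = poly_op q T x"
  define v where "v = poly_op [:- z, 1:] T u"
  have v0: "v \<noteq> 0" using x unfolding v_def u_def poly_op_mult[OF T] .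
  have "T u - z *\<^sub>C u = v"
    by (simp add: v_def poly_op_linear_factor[OF T] scaleC_minus_left)
  then have u: "T u = z *\<^sub>C u + v" by (simp add: algebra_simps)
  have "poly_op [:- z, 1:] T v = 0"
    using m by (simp only: v_def u_def poly_op_mult[OF T, symmetric] q[symmetric] is_minimal_poly_def)
  then have v: "T v = z *\<^sub>C v"
    by (simp add: poly_op_linear_factor[OF T] scaleC_minus_left)
  have "real k * norm v \<le> (C + 1) * norm u" for k
  proof -
    have "norm (of_nat k *\<^sub>C v) \<le> norm (z *\<^sub>C u + of_nat k *\<^sub>C v) + norm (z *\<^sub>C u)"
      by (metis add_diff_cancel_left' norm_triangle_ineq4)
    also have "norm (z *\<^sub>C u + of_nat k *\<^sub>C v) = norm ((T ^^ k) u)"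
      using arg_cong[OF funpow_generalized_eigenvector[OF T v u, of k], of norm] z
      by (simp add: norm_scaleC norm_power)
    finally show ?thesis using pow[of k u] z by (simp add: norm_scaleC algebra_simps)
  qed
  moreover obtain k where "(C + 1) * norm u < real k * norm v"
    using reals_Archimedean3[of "norm v"] v0 by auto
  ultimately show False by (meson not_le)
qed

lemma unimodular_zeros_distinct:
  fixes T :: "'a::complex_banach \<Rightarrow> 'a"
  assumes T: "bounded_clinear T" and pow: "\<And>k x. norm ((T ^^ k) x) \<le> C * norm x"
    and m: "is_minimal_poly T (\<Prod>i\<in>S. [:- \<mu> i, 1:])" and S: "finite S"
    and \<mu>: "\<And>i. i \<in> S \<Longrightarrow> cmod (\<mu> i) = 1"
  shows "inj_on \<mu> S"
proof (rule inj_onI, rule ccontr)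
  fix i j assume ij: "i \<in> S" "j \<in> S" "\<mu> i = \<mu> j" "i \<noteq> j"
  let ?P = "\<lambda>S. \<Prod>k\<in>S. [:- \<mu> k, 1:]"
  have "?P S = [:- \<mu> i, 1:] * ?P (S - {i})"
    using S ij(1) by (rule prod.remove)
  also have "?P (S - {i}) = [:- \<mu> j, 1:] * ?P (S - {i} - {j})"
    by (rule prod.remove) (use S ij in auto)
  finally have "?P S = [:- \<mu> i, 1:] * ([:- \<mu> j, 1:] * ?P (S - {i} - {j}))" .
  then have "[:- \<mu> i, 1:] * [:- \<mu> i, 1:] dvd (\<Prod>k\<in>S. [:- \<mu> k, 1:])"
    unfolding ij(3) mult.assoc[symmetric] by (rule dvdI)
  then show False using unimodular_zero_simple[OF T pow m \<mu>[OF ij(1)]] by simp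
qed


section \<open>Resolvent bounds\<close>

lemma onorm_resolvent_le:
  assumes "bounded_clinear T" "is_minimal_poly T m" "poly m \<zeta> \<noteq> 0" and "0 \<le> B"
    and "\<And>y. norm y \<le> B * norm (\<zeta> *\<^sub>C y - T y)"
  shows "onorm (resolvent \<zeta> T) \<le> B"
proof (rule onorm_bound[OF \<open>0 \<le> B\<close>])
  show "norm (resolvent \<zeta> T x) \<le> B * norm x" for x
    using assms(5)[of "resolvent \<zeta> T x"] resolvent_inverse(3)[OF assms(1-3), of x] by simp
qed

lemma onorm_inverse_le:
  fixes T :: "'a::complex_banach \<Rightarrow> 'a"
  assumes T: "bounded_clinear T" and m: "is_minimal_poly T m" "poly m 0 \<noteq> 0" and "0 \<le> B"
    and lower: "\<And>y. norm y \<le> B * norm (0 *\<^sub>C y - T y)"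
  shows "onorm (inv T) \<le> B"
proof (rule onorm_bound[OF \<open>0 \<le> B\<close>])
  fix x
  have "T (- resolvent 0 T x) = x"
    using resolvent_inverse(3)[OF T m, of x] by (simp add: bounded_clinearD[OF T])
  then have "T (inv T x) = x" by (metis f_inv_into_f rangeI)
  then show "norm (inv T x) \<le> B * norm x"
    using lower[of "inv T x"] by simp
qed

theorem theorem8:
  fixes T :: "'a::complex_banach \<Rightarrow> 'a" and n N :: nat and C :: real
    and m :: "complex poly" and \<mu> :: "nat \<Rightarrow> complex"
  assumes "n \<ge> 1" and "1 \<le> C"
    and "T \<in> power_bounded_ops n C"
    and "is_minimal_poly T m" and "N = degree m"
    and "m = (\<Prod>i\<in>{1..N}. [:- \<mu> i, 1:])"
  shows
    "((\<forall>i\<in>{1..N}. cmod (\<mu> i) = 1) \<longrightarrow>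
        (\<forall>\<zeta>. \<zeta> \<notin> \<mu> ` {1..N} \<longrightarrow>
          onorm (resolvent \<zeta> T) \<le> C * (sqrt (real N) / (MIN i\<in>{1..N}. cmod (\<zeta> - \<mu> i)))))
     \<and>
     (\<forall>r. r = (MIN i\<in>{1..N}. cmod (\<mu> i)) \<and> r > 0 \<longrightarrow>
        onorm (inv T) \<le> C * (sqrt (real N * (exp 1 - r ^ (2 * N))) / r ^ N))
     \<and>
     (\<forall>\<zeta> r. cmod \<zeta> < 1 \<and>
            r = (MIN i\<in>{1..N}. cmod ((\<zeta> - \<mu> i) / (1 - cnj (\<mu> i) * \<zeta>))) \<and>
            0 < r \<and> r < 1 \<longrightarrow>
        onorm (resolvent \<zeta> T) \<le>
          C * exp 1 * sqrt 2 *
          (sqrt (real N) / ((MIN i\<in>{1..N}. cmod (1 - cnj (\<mu> i) * \<zeta>)) * r ^ N)) *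
          sqrt (1 / (1 - r * cmod \<zeta>) + 1 / (2 * (1 - r\<^sup>2) * real N)))
     \<and>
     (\<forall>\<zeta>. cmod \<zeta> = 1 \<and> \<zeta> \<notin> spectrum T \<longrightarrow>
        onorm (resolvent \<zeta> T) \<le>
          3 / 2 * C * sqrt ((exp 1)\<^sup>2 - 1) *
          (real N / (MIN i\<in>{1..N}. cmod (\<zeta> - \<mu> i))))"
proof -
  let ?S = "{1..N}"
  have T: "bounded_clinear T" using assms(3) by (simp add: power_bounded_ops_def)
  have C: "0 \<le> C" using assms(2) by simp
  have pow: "norm ((T ^^ k) x) \<le> C * norm x" for k x
  proof -
    have "bounded_linear (T ^^ k)"
      using bounded_clinear_funpow[OF T] by (simp add: bounded_clinear_def)
    then have "norm ((T ^^ k) x) \<le> onorm (T ^^ k) * norm x" by (rule onorm)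
    also have "\<dots> \<le> C * norm x"
      using assms(3) by (intro mult_right_mono) (auto simp: power_bounded_ops_def)
    finally show ?thesis .
  qed
  have ann: "poly_op (\<Prod>i\<in>?S. [:- \<mu> i, 1:]) T x = 0" for x
    using assms(4) unfolding is_minimal_poly_def assms(6)[symmetric] by simp
  have roots: "poly m \<zeta> = 0 \<longleftrightarrow> \<zeta> \<in> \<mu> ` ?S" for \<zeta>
    unfolding assms(6) by (auto simp: poly_prod)
  have \<mu>1: "cmod (\<mu> i) \<le> 1" if "i \<in> ?S" for i
    using minimal_poly_zero_le_1[OF T pow assms(4)] roots that by blast
  show ?thesis
  proof (cases "N = 0")
    case True
    \<comment> \<open>The minimal polynomial is the constant \<open>1\<close>, so the identity vanishes. All minima below are over the
      empty set, but each right-hand side contains a factor \<open>0\<close>.\<close>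
    have "x = 0" for x :: 'a
      using ann[of x] poly_op_linear_factor[OF T, of 1 0 x] True by (simp add: one_pCons)
    then have trivial: "onorm f \<le> 0" for f :: "'a \<Rightarrow> 'a"
      by (intro onorm_bound) (metis norm_zero mult_zero_left order_refl)+
    then show ?thesis using True by simp
  next
    case False
    then have S: "finite ?S" "card ?S = N" "N \<ge> 1" and ne: "?S \<noteq> {}" by auto
    have min_le: "(MIN i\<in>?S. g i) \<le> g i" if "i \<in> ?S" for g :: "nat \<Rightarrow> real" and i
      using that by simp
    have attained: "\<exists>i\<in>?S. (MIN i\<in>?S. g i) = g i" for g :: "nat \<Rightarrow> real"
    proof -
      have "Min (g ` ?S) \<in> g ` ?S" using ne by (intro Min_in) auto
      then show ?thesis by blast
    qed
    have min_pos: "(MIN i\<in>?S. g i) > 0" if "\<And>i. i \<in> ?S \<Longrightarrow> g i > 0" for g :: "nat \<Rightarrow> real"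
      using attained[of g] that by auto
    show ?thesis
    proof (intro conjI allI impI; (elim conjE)?)
      fix \<zeta>
      assume uni: "\<forall>i\<in>?S. cmod (\<mu> i) = 1" and \<zeta>: "\<zeta> \<notin> \<mu> ` ?S"
      have inj: "inj_on \<mu> ?S"
        using unimodular_zeros_distinct[OF T pow assms(4)[unfolded assms(6)] S(1)] uni by blast
      define d where "d = (MIN i\<in>?S. cmod (\<zeta> - \<mu> i))"
      have d: "d > 0" unfolding d_def using \<zeta> by (intro min_pos) auto
      have "norm y \<le> C * (sqrt (real N) / d) * norm (\<zeta> *\<^sub>C y - T y)" for y
        by (rule unimodular_spectrum_lower_bound[OF T pow C S(1,2) inj _ ann d])
          (use uni in \<open>auto simp: d_def intro!: min_le\<close>)
      then show "onorm (resolvent \<zeta> T) \<le> C * (sqrt (real N) / (MIN i\<in>?S. cmod (\<zeta> - \<mu> i)))"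
        unfolding d_def[symmetric]
        by (intro onorm_resolvent_le[OF T assms(4)]) (use \<zeta> roots C d in auto)
    next
      fix r assume r: "r = (MIN i\<in>?S. cmod (\<mu> i))" "r > 0"
      have r_le: "r \<le> cmod (\<mu> i)" if "i \<in> ?S" for i
        unfolding r(1) using that by (rule min_le)
      obtain j where j: "j \<in> ?S" "r = cmod (\<mu> j)" using attained[of "\<lambda>i. cmod (\<mu> i)"] r(1) by auto
      have "r ^ (2 * N) \<le> 1"
        using \<mu>1[OF j(1)] r(2) unfolding j(2) by (intro power_le_one) auto
      also have "1 \<le> exp (1::real)" by simp
      finally have nonneg: "0 \<le> C * (sqrt (real N * (exp 1 - r ^ (2 * N))) / r ^ N)"
        using C r(2) by simp
      have "0 \<notin> \<mu> ` ?S" using r_le r(2) by fastforce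
      then show "onorm (inv T) \<le> C * (sqrt (real N * (exp 1 - r ^ (2 * N))) / r ^ N)"
        by (intro onorm_inverse_le[OF T assms(4) _ nonneg]
            zero_lower_bound[OF T pow C S \<mu>1 ann r(2) r_le]) (use roots in auto)
    next
      fix \<zeta> r assume \<zeta>: "cmod \<zeta> < 1"
        and r: "r = (MIN i\<in>?S. cmod ((\<zeta> - \<mu> i) / (1 - cnj (\<mu> i) * \<zeta>)))" "0 < r" "r < 1"
      define d where "d = (MIN i\<in>?S. cmod (1 - cnj (\<mu> i) * \<zeta>))"
      have r_le: "r \<le> cmod ((\<zeta> - \<mu> i) / (1 - cnj (\<mu> i) * \<zeta>))" if "i \<in> ?S" for i
        unfolding r(1) using that by (rule min_le)
      have d_le: "d \<le> cmod (1 - cnj (\<mu> i) * \<zeta>)" if "i \<in> ?S" for i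
        unfolding d_def using that by (rule min_le)
      have nz: "\<zeta> - \<mu> i \<noteq> 0" "1 - cnj (\<mu> i) * \<zeta> \<noteq> 0" if "i \<in> ?S" for i
        using r_le[OF that] r(2) by (auto simp del: right_minus_eq)
      have d: "d > 0" unfolding d_def using nz(2) by (intro min_pos) (simp only: zero_less_norm_iff simp_thms)
      obtain j where j: "j \<in> ?S" "r = cmod ((\<zeta> - \<mu> j) / (1 - cnj (\<mu> j) * \<zeta>))"
        using attained[of "\<lambda>i. cmod ((\<zeta> - \<mu> i) / (1 - cnj (\<mu> i) * \<zeta>))"] r(1) by auto
      have "r * cmod \<zeta> \<le> 1" "r\<^sup>2 \<le> 1"
        using r \<zeta> by (auto simp: mult_le_one abs_square_le_1)
      then have nonneg: "0 \<le> C * exp 1 * sqrt 2 * (sqrt (real N) / (d * r ^ N)) *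
          sqrt (1 / (1 - r * cmod \<zeta>) + 1 / (2 * (1 - r\<^sup>2) * real N))"
        using C d r(2) by simp
      have "\<zeta> \<notin> \<mu> ` ?S" using nz(1) by (metis imageE right_minus_eq)
      then show "onorm (resolvent \<zeta> T) \<le> C * exp 1 * sqrt 2 *
          (sqrt (real N) / ((MIN i\<in>?S. cmod (1 - cnj (\<mu> i) * \<zeta>)) * r ^ N)) *
          sqrt (1 / (1 - r * cmod \<zeta>) + 1 / (2 * (1 - r\<^sup>2) * real N))"
        unfolding d_def[symmetric]
        by (intro onorm_resolvent_le[OF T assms(4) _ nonneg]
            disk_lower_bound[OF T pow C S \<mu>1 ann \<zeta> r(2,3) r_le j d d_le]) (use roots in auto)
    next
      fix \<zeta> assume \<zeta>: "cmod \<zeta> = 1" "\<zeta> \<notin> spectrum T"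
      then have nr: "\<zeta> \<notin> \<mu> ` ?S"
        using spectrum_eq_zeros[OF T assms(4)] roots by simp
      define d where "d = (MIN i\<in>?S. cmod (\<zeta> - \<mu> i))"
      have d: "d > 0" unfolding d_def using nr by (intro min_pos) auto
      have d_le: "d \<le> cmod (\<zeta> - \<mu> i)" if "i \<in> ?S" for i
        unfolding d_def using that by (rule min_le)
      have nonneg: "0 \<le> C * (sqrt ((exp 1)\<^sup>2 - 1) * (real N / d))"
        using C d by simp
      have "onorm (resolvent \<zeta> T) \<le> C * (sqrt ((exp 1)\<^sup>2 - 1) * (real N / d))"
        by (intro onorm_resolvent_le[OF T assms(4) _ nonneg]
            circle_lower_bound[OF T pow C S \<mu>1 ann \<zeta>(1) d d_le]) (use roots nr in auto)
      also have "\<dots> \<le> 3 / 2 * (C * (sqrt ((exp 1)\<^sup>2 - 1) * (real N / d)))"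
        using nonneg by linarith
      finally show "onorm (resolvent \<zeta> T) \<le>
          3 / 2 * C * sqrt ((exp 1)\<^sup>2 - 1) * (real N / (MIN i\<in>?S. cmod (\<zeta> - \<mu> i)))"
        unfolding d_def[symmetric] by (simp only: mult.assoc)
    qed
  qed
qed

end
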